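(* (i) The operator $\delta$ can be extended to processes $u\in L^2(\Omega\times\mathbb{N})$ by $$\delta(u)=\sum_{k=0}^\infty u_kY_k-\sum_{k=0}^\infty D_ku_k-\sum_{k=0}^\infty\varphi_k\,D_ku_k\,Y_k,$$ provided that all the series converge in $L^2(\Omega)$; that is, the right-hand side is linear in $u$ and coincides with $\delta(u)$ for every $u\in\mathcal{U}$ for which the three series converge in $L^2(\Omega)$. (ii) For all $u\in\mathcal{U}$, $$E[|\delta(u)|^2]=E\big[\|u\|_{\ell^2(\mathbb{N})}^2\big]+E\Bigg[\sum_{k,l=0,\ k\ne l}^\infty D_ku_l\,D_lu_k-\sum_{k=0}^\infty(D_ku_k)^2\Bigg].$$
   Context: $\mathbb{N}=\{0,1,2,\ldots\}$. Let $(p_k)_{k\in\mathbb{N}}$ be a deterministic sequence in $(0,1)$ and $q_k=1-p_k$. Let $\Omega=\{-1,1\}^{\mathbb{N}}$ with its product $\sigma$-algebra, let $X_k:\Omega\to\{-1,1\}$ be the canonical projections, and let $\mathbb{P}$ be the product probability measure under which the $X_k$ are independent with $\mathbb{P}(X_k=1)=p_k$, $\mathbb{P}(X_k=-1)=q_k$. Set $Y_k=\frac{q_k-p_k+X_k}{2\sqrt{p_kq_k}}$ and $\varphi_k=\frac{q_k-p_k}{\sqrt{p_kq_k}}$, so that $Y_k^2=1+\varphi_kY_k$. Let $\ell^2(\mathbb{N})^{\circ n}$ be the space of symmetric functions in $\ell^2(\mathbb{N}^n)$, and $\Delta_n=\{(k_1,\ldots,k_n)\in\mathbb{N}^n: k_i\ne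 k_j,\ 1\le i<j\le n\}$. For $f_n\in\ell^2(\mathbb{N})^{\circ n}$, $n\ge1$, put $J_n(f_n)=\sum_{(i_1,\ldots,i_n)\in\Delta_n}f_n(i_1,\ldots,i_n)Y_{i_1}\cdots Y_{i_n}$ (convergence in $L^2(\Omega)$), and $J_0(f_0)=f_0$ for $f_0\in\mathbb{R}$. For $F:\Omega\to\mathbb{R}$, $D_kF(\omega)=\sqrt{p_kq_k}\,(F(\omega_+^k)-F(\omega_-^k))$, where $\omega_\pm^k$ is $\omega$ with its $k$-th coordinate replaced by $\pm1$. $\mathcal{U}\subset L^2(\Omega\times\mathbb{N})$ is the space of processes of the form $u_k=\sum_{j=0}^nJ_j(f_{j+1}( *,k))$, $k\in\mathbb{N}$, with $f_{j+1}\in\ell^2(\mathbb{N})^{\circ j}\otimes\ell^2(\mathbb{N})$ (square-summable functions of $j+1$ variables, symmetric in the first $j$ variables, denoted $*$), $n\in\mathbb{N}$. The divergence $\delta:\mathcal{U}\to L^2(\Omega)$ is the linear map with $\delta(u)=J_{n+1}(\tilde f_{n+1})$ when $u_k=J_n(f_{n+1}( *,k))$, where $\tilde f_{n+1}(k_1,\ldots,k_{n+1})=\frac1{n+1}\sum_{i=1}^{n+1}f_{n+1}(k_1,\ldots,k_{i-1},k_{i+1},\ldots,k_{n+1},k_i)$ is the symmetrization of $f_{n+1}$. *)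

theory Defs
  imports "HOL-Probability.Infinite_Product_Measure"
begin

section \<open>The Bernoulli space\<close>

text \<open>The underlying set of \<open>bernoulli_space p\<close> is the set of all sequences with values in
  \<open>{-1, 1}\<close>; the coordinate \<open>X\<^sub>k\<close> of a sample point \<open>\<omega>\<close> is \<open>\<omega> k\<close>.\<close>

definition sign_law :: "real \<Rightarrow> real measure" where
  "sign_law a = point_measure {-1, 1} (\<lambda>x. ennreal (if x = 1 then a else 1 - a))"

definition bernoulli_space :: "(nat \<Rightarrow> real) \<Rightarrow> (nat \<Rightarrow> real) measure" where
  "bernoulli_space p = (\<Pi>\<^sub>M k\<in>UNIV. sign_law (p k))"

abbreviation q_of :: "(nat \<Rightarrow> real) \<Rightarrow> nat \<Rightarrow> real" where
  "q_of p k \<equiv> 1 - p k"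

definition Y :: "(nat \<Rightarrow> real) \<Rightarrow> nat \<Rightarrow> (nat \<Rightarrow> real) \<Rightarrow> real" where
  "Y p k \<omega> = (q_of p k - p k + \<omega> k) / (2 * sqrt (p k * q_of p k))"

definition phi :: "(nat \<Rightarrow> real) \<Rightarrow> nat \<Rightarrow> real" where
  "phi p k = (q_of p k - p k) / sqrt (p k * q_of p k)"

definition grad :: "(nat \<Rightarrow> real) \<Rightarrow> nat \<Rightarrow> ((nat \<Rightarrow> real) \<Rightarrow> real) \<Rightarrow> (nat \<Rightarrow> real) \<Rightarrow> real" where
  "grad p k F x = sqrt (p k * q_of p k) * (F (x(k := 1)) - F (x(k := -1)))"

section \<open>Square-integrable functions and convergence in mean square\<close>

text \<open>Elements of an \<open>L\<^sup>2\<close> space are given by representing functions, so equality in \<open>L\<^sup>2\<close> is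
  almost everywhere equality.\<close>

definition L2 :: "'a measure \<Rightarrow> ('a \<Rightarrow> real) set" where
  "L2 M = {F \<in> borel_measurable M. integrable M (\<lambda>\<omega>. (F \<omega>)\<^sup>2)}"

definition L2_tendsto :: "'a measure \<Rightarrow> ('i \<Rightarrow> 'a \<Rightarrow> real) \<Rightarrow> ('a \<Rightarrow> real) \<Rightarrow> 'i filter \<Rightarrow> bool" where
  "L2_tendsto M S F A \<longleftrightarrow> F \<in> L2 M \<and> (\<forall>\<^sub>F i in A. S i \<in> L2 M) \<and>
     ((\<lambda>i. \<integral>\<omega>. (S i \<omega> - F \<omega>)\<^sup>2 \<partial>M) \<longlongrightarrow> 0) A"

definition L2_sums :: "'a measure \<Rightarrow> (nat \<Rightarrow> 'a \<Rightarrow> real) \<Rightarrow> ('a \<Rightarrow> real) \<Rightarrow> bool" where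
  "L2_sums M g S \<longleftrightarrow> L2_tendsto M (\<lambda>n \<omega>. \<Sum>k<n. g k \<omega>) S sequentially"

definition L2_summable :: "'a measure \<Rightarrow> (nat \<Rightarrow> 'a \<Rightarrow> real) \<Rightarrow> bool" where
  "L2_summable M g \<longleftrightarrow> (\<exists>S. L2_sums M g S)"

definition L2_suminf :: "'a measure \<Rightarrow> (nat \<Rightarrow> 'a \<Rightarrow> real) \<Rightarrow> 'a \<Rightarrow> real" where
  "L2_suminf M g = (SOME S. L2_sums M g S)"

text \<open>\<open>L\<^sup>2(\<Omega> \<times> \<nat>)\<close>, for the product of the probability measure and the counting measure.\<close>

definition process_L2 :: "(nat \<Rightarrow> real) \<Rightarrow> (nat \<Rightarrow> (nat \<Rightarrow> real) \<Rightarrow> real) set" where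
  "process_L2 p =
     {u. (\<lambda>(\<omega>, k). u k \<omega>) \<in> L2 (bernoulli_space p \<Otimes>\<^sub>M count_space UNIV)}"

section \<open>Multiple stochastic integrals\<close>

text \<open>A function of \<open>n\<close> variables in \<open>\<nat>\<close> is a function on lists, of which only the values at
  lists of length \<open>n\<close> matter. For \<open>n = 0\<close> it is the constant \<open>f []\<close>, and the defining sum of
  \<open>multint p 0 f\<close> has the single term \<open>f []\<close>.\<close>

definition Delta :: "nat \<Rightarrow> nat list set" where
  "Delta n = {ks. length ks = n \<and> distinct ks}"

definition multint :: "(nat \<Rightarrow> real) \<Rightarrow> nat \<Rightarrow> (nat list \<Rightarrow> real) \<Rightarrow> (nat \<Rightarrow> real) \<Rightarrow> real" where
  "multint p n f = (SOME F. L2_tendsto (bernoulli_space p)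
     (\<lambda>A \<omega>. \<Sum>ks\<in>A. f ks * (\<Prod>k\<leftarrow>ks. Y p k \<omega>)) F (finite_subsets_at_top (Delta n)))"

text \<open>Square-summable functions of \<open>n + 1\<close> variables, symmetric in the first \<open>n\<close> of them.\<close>

definition kernels :: "nat \<Rightarrow> (nat list \<Rightarrow> real) set" where
  "kernels n = {f. (\<lambda>ks. (f ks)\<^sup>2) summable_on {ks. length ks = Suc n} \<and>
     (\<forall>ks ls k. length ks = n \<longrightarrow> mset ls = mset ks \<longrightarrow> f (ls @ [k]) = f (ks @ [k]))}"

text \<open>The symmetrization of a function in \<open>kernels n\<close>: average over the position \<open>i\<close> of the entry
  that is moved to the end of the list.\<close>

definition symmetrization :: "nat \<Rightarrow> (nat list \<Rightarrow> real) \<Rightarrow> nat list \<Rightarrow> real" where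
  "symmetrization n f ks =
     (1 / real (n + 1)) * (\<Sum>i<n + 1. f (take i ks @ drop (Suc i) ks @ [ks ! i]))"

section \<open>The divergence\<close>

text \<open>\<open>f j\<close> is the kernel with \<open>j + 1\<close> variables in the chaos expansion of \<open>u\<close>.\<close>

definition chaos_expansion ::
  "(nat \<Rightarrow> real) \<Rightarrow> nat \<Rightarrow> (nat \<Rightarrow> nat list \<Rightarrow> real) \<Rightarrow> (nat \<Rightarrow> (nat \<Rightarrow> real) \<Rightarrow> real) \<Rightarrow> bool" where
  "chaos_expansion p n f u \<longleftrightarrow> (\<forall>j\<le>n. f j \<in> kernels j) \<and>
     (\<forall>k. u k \<in> borel_measurable (bernoulli_space p) \<and>
       (AE \<omega> in bernoulli_space p. u k \<omega> = (\<Sum>j\<le>n. multint p j (\<lambda>ks. f j (ks @ [k])) \<omega>)))"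

definition chaos_processes :: "(nat \<Rightarrow> real) \<Rightarrow> (nat \<Rightarrow> (nat \<Rightarrow> real) \<Rightarrow> real) set" where
  "chaos_processes p = {u. \<exists>n f. chaos_expansion p n f u}"

text \<open>The linear extension of the prescription on homogeneous processes. The process \<open>u\<close>
  determines the values of \<open>f j\<close> at all \<open>ks @ [k]\<close> with \<open>ks\<close> distinct (up to trailing zero
  kernels), hence its symmetrization on \<open>Delta (j + 1)\<close>; so all choices of an expansion give
  the same divergence up to a null set.\<close>

definition is_divergence ::
  "(nat \<Rightarrow> real) \<Rightarrow> (nat \<Rightarrow> (nat \<Rightarrow> real) \<Rightarrow> real) \<Rightarrow> ((nat \<Rightarrow> real) \<Rightarrow> real) \<Rightarrow> bool" where
  "is_divergence p u G \<longleftrightarrow> (\<exists>n f. chaos_expansion p n f u \<and>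
     G = (\<lambda>\<omega>. \<Sum>j\<le>n. multint p (j + 1) (symmetrization j (f j)) \<omega>))"

definition divergence ::
  "(nat \<Rightarrow> real) \<Rightarrow> (nat \<Rightarrow> (nat \<Rightarrow> real) \<Rightarrow> real) \<Rightarrow> (nat \<Rightarrow> real) \<Rightarrow> real" where
  "divergence p u = (SOME G. is_divergence p u G)"

definition series_converge :: "(nat \<Rightarrow> real) \<Rightarrow> (nat \<Rightarrow> (nat \<Rightarrow> real) \<Rightarrow> real) \<Rightarrow> bool" where
  "series_converge p u \<longleftrightarrow>
     L2_summable (bernoulli_space p) (\<lambda>k \<omega>. u k \<omega> * Y p k \<omega>) \<and>
     L2_summable (bernoulli_space p) (\<lambda>k \<omega>. grad p k (u k) \<omega>) \<and>
     L2_summable (bernoulli_space p) (\<lambda>k \<omega>. phi p k * grad p k (u k) \<omega> * Y p k \<omega>)"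

definition divergence_ext ::
  "(nat \<Rightarrow> real) \<Rightarrow> (nat \<Rightarrow> (nat \<Rightarrow> real) \<Rightarrow> real) \<Rightarrow> (nat \<Rightarrow> real) \<Rightarrow> real" where
  "divergence_ext p u \<omega> =
     L2_suminf (bernoulli_space p) (\<lambda>k \<omega>. u k \<omega> * Y p k \<omega>) \<omega>
     - L2_suminf (bernoulli_space p) (\<lambda>k \<omega>. grad p k (u k) \<omega>) \<omega>
     - L2_suminf (bernoulli_space p) (\<lambda>k \<omega>. phi p k * grad p k (u k) \<omega> * Y p k \<omega>) \<omega>"

text \<open>The domain of \<open>divergence_ext p\<close>.\<close>

definition ext_domain :: "(nat \<Rightarrow> real) \<Rightarrow> (nat \<Rightarrow> (nat \<Rightarrow> real) \<Rightarrow> real) set" where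
  "ext_domain p = {u \<in> process_L2 p. series_converge p u}"

text \<open>Linearity on classes: \<open>w\<close> ranges over all representatives of \<open>a u + b v\<close>, so this includes
  the independence of the choice of representatives.\<close>

definition L2_process_linear ::
  "(nat \<Rightarrow> real) \<Rightarrow> (nat \<Rightarrow> (nat \<Rightarrow> real) \<Rightarrow> real) set \<Rightarrow>
   ((nat \<Rightarrow> (nat \<Rightarrow> real) \<Rightarrow> real) \<Rightarrow> (nat \<Rightarrow> real) \<Rightarrow> real) \<Rightarrow> bool" where
  "L2_process_linear p U T \<longleftrightarrow>
     (\<forall>u\<in>U. \<forall>v\<in>U. \<forall>a b. \<forall>w\<in>process_L2 p.
        (\<forall>k. AE \<omega> in bernoulli_space p. w k \<omega> = a * u k \<omega> + b * v k \<omega>) \<longrightarrow>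
        w \<in> U \<and> (AE \<omega> in bernoulli_space p. T w \<omega> = a * T u \<omega> + b * T v \<omega>))"

end

theory Submission
  imports Defs "HOL-Combinatorics.Multiset_Permutations"
begin

text \<open>
  Let \<open>C\<^sub>k u\<^sub>k\<close> be the mean of \<open>u\<^sub>k\<close> over the \<open>k\<close>-th coordinate, so that
  \<open>u\<^sub>k = C\<^sub>k u\<^sub>k + Y\<^sub>k D\<^sub>k u\<^sub>k\<close>. As \<open>Y\<^sub>k\<^sup>2 = 1 + \<phi>\<^sub>k Y\<^sub>k\<close>, the \<open>k\<close>-th terms of the three series combine to
  \<open>Z\<^sub>k = (C\<^sub>k u\<^sub>k) Y\<^sub>k\<close>. Integration by parts, \<open>E[F Y\<^sub>k G] = E[(D\<^sub>k F) G]\<close> for \<open>G\<close> not depending on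
  the \<open>k\<close>-th coordinate, gives \<open>E[Z\<^sub>k\<^sup>2] = E[u\<^sub>k\<^sup>2] - E[(D\<^sub>k u\<^sub>k)\<^sup>2]\<close> and
  \<open>E[Z\<^sub>k Z\<^sub>l] = E[D\<^sub>k u\<^sub>l D\<^sub>l u\<^sub>k]\<close> for \<open>k \<noteq> l\<close>. Since the components of \<open>u\<close> have bounded chaos degree,
  the sum over \<open>k\<close> of \<open>E[(D\<^sub>k u\<^sub>l)\<^sup>2]\<close> is at most a constant times the squared norm of the kernels at \<open>l\<close>.
  Hence the series of the \<open>Z\<^sub>k\<close> converges unconditionally in \<open>L\<^sup>2\<close>, for every process in the domain of
  the divergence. Its limit and the divergence have the same scalar products with all finite products
  of the \<open>Y\<^sub>k\<close>, and these are complete in \<open>L\<^sup>2\<close>. Both claims follow.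
\<close>

section \<open>Mean square convergence\<close>

text \<open>The three series need not converge one by one for a process with a finite expansion. For
  u_k = Y_k / (k + 1) the gradients are D_k u_k = 1 / (k + 1) and their series diverges, while every
  Z_k vanishes and so does the divergence. Hence claim (ii) cannot be deduced from the formula in
  claim (i), and both rest on the combined terms Z_k. The obstacle is the off-diagonal part: the
  squared norms of the components do not control E[D_k u_l D_l u_k]. Finite degree helps because a
  product of j distinct factors Y_i has a nonzero gradient in j directions only, so that summing
  over all directions costs a factor of at most j. The same estimate yields the absolute summability
  needed to exchange expectation and double series. The divergence is defined through a chosen
  expansion. Its coefficient at a finite set B turns out to be the sum over l in B of the
  coefficient of u_l at B without l. This refers to u alone, and it is also the coefficient of the
  sum of the Z_k.\<close>

lemma L2_measurable: "F \<in> L2 M \<Longrightarrow> F \<in> borel_measurable M"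
  by (simp add: L2_def)

lemma L2_integrable_square: "F \<in> L2 M \<Longrightarrow> integrable M (\<lambda>\<omega>. (F \<omega>)\<^sup>2)"
  by (simp add: L2_def)

lemma L2_integrable_mult:
  assumes "F \<in> L2 M" "G \<in> L2 M"
  shows "integrable M (\<lambda>\<omega>. F \<omega> * G \<omega>)"
proof (rule Bochner_Integration.integrable_bound)
  show "integrable M (\<lambda>\<omega>. (F \<omega>)\<^sup>2 + (G \<omega>)\<^sup>2)"
    using assms by (auto simp: L2_def)
  show "(\<lambda>\<omega>. F \<omega> * G \<omega>) \<in> borel_measurable M"
    using assms by (auto simp: L2_def)
  have "\<bar>a * b\<bar> \<le> a\<^sup>2 + b\<^sup>2" for a b :: real
  proof -
    have "2 * \<bar>a * b\<bar> \<le> a\<^sup>2 + b\<^sup>2"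
      using sum_squares_bound[of "\<bar>a\<bar>" "\<bar>b\<bar>"] by (simp add: abs_mult)
    then show ?thesis using abs_ge_zero[of "a * b"] by linarith
  qed
  then show "AE \<omega> in M. norm (F \<omega> * G \<omega>) \<le> norm ((F \<omega>)\<^sup>2 + (G \<omega>)\<^sup>2)"
    by auto
qed

lemma L2_zero [simp]: "(\<lambda>_. 0) \<in> L2 M"
  by (simp add: L2_def)

lemma L2_add:
  assumes "F \<in> L2 M" "G \<in> L2 M"
  shows "(\<lambda>\<omega>. F \<omega> + G \<omega>) \<in> L2 M"
proof -
  have "integrable M (\<lambda>\<omega>. (F \<omega>)\<^sup>2 + (G \<omega>)\<^sup>2 + 2 * (F \<omega> * G \<omega>))"
    using assms by (intro Bochner_Integration.integrable_add integrable_mult_right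
        L2_integrable_mult L2_integrable_square)
  then show ?thesis
    using assms by (auto simp: L2_def power2_sum mult.assoc)
qed

lemma L2_cmult: "F \<in> L2 M \<Longrightarrow> (\<lambda>\<omega>. a * F \<omega>) \<in> L2 M"
  by (auto simp: L2_def power_mult_distrib)

lemma L2_diff: "F \<in> L2 M \<Longrightarrow> G \<in> L2 M \<Longrightarrow> (\<lambda>\<omega>. F \<omega> - G \<omega>) \<in> L2 M"
  using L2_add[of F M "\<lambda>\<omega>. - 1 * G \<omega>"] L2_cmult[of G M "- 1"] by simp

lemma L2_sum: "(\<And>i. i \<in> A \<Longrightarrow> F i \<in> L2 M) \<Longrightarrow> (\<lambda>\<omega>. \<Sum>i\<in>A. F i \<omega>) \<in> L2 M"
  by (induction A rule: infinite_finite_induct) (auto intro: L2_add)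

lemma L2_cong_AE:
  assumes "F \<in> L2 M" "G \<in> borel_measurable M" "AE \<omega> in M. G \<omega> = F \<omega>"
  shows "G \<in> L2 M"
proof -
  have "integrable M (\<lambda>\<omega>. (G \<omega>)\<^sup>2) = integrable M (\<lambda>\<omega>. (F \<omega>)\<^sup>2)"
    using assms by (intro integrable_cong_AE) (auto simp: L2_def)
  then show ?thesis using assms by (auto simp: L2_def)
qed

lemma L2_bounded_mult:
  assumes "F \<in> L2 M" "G \<in> borel_measurable M" "\<And>\<omega>. \<omega> \<in> space M \<Longrightarrow> \<bar>G \<omega>\<bar> \<le> c"
  shows "(\<lambda>\<omega>. F \<omega> * G \<omega>) \<in> L2 M"
proof -
  have "integrable M (\<lambda>\<omega>. (F \<omega> * G \<omega>)\<^sup>2)"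
  proof (rule Bochner_Integration.integrable_bound)
    show "integrable M (\<lambda>\<omega>. c\<^sup>2 * (F \<omega>)\<^sup>2)"
      using assms by (auto simp: L2_def)
    show "(\<lambda>\<omega>. (F \<omega> * G \<omega>)\<^sup>2) \<in> borel_measurable M"
      using assms by (auto simp: L2_def)
    have "(F \<omega> * G \<omega>)\<^sup>2 \<le> c\<^sup>2 * (F \<omega>)\<^sup>2" if "\<omega> \<in> space M" for \<omega>
    proof -
      have "(G \<omega>)\<^sup>2 \<le> c\<^sup>2"
        using assms(3)[OF that] by (metis abs_ge_zero power2_abs power_mono)
      then show ?thesis
        by (simp add: power_mult_distrib mult.commute[of "c\<^sup>2"] mult_left_mono)
    qed
    then show "AE \<omega> in M. norm ((F \<omega> * G \<omega>)\<^sup>2) \<le> norm (c\<^sup>2 * (F \<omega>)\<^sup>2)"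
      by (intro AE_I2) (auto simp: abs_mult)
  qed
  then show ?thesis using assms by (auto simp: L2_def)
qed

lemma L2_Cauchy_Schwarz:
  assumes "F \<in> L2 M" "G \<in> L2 M"
  shows "(\<integral>\<omega>. F \<omega> * G \<omega> \<partial>M)\<^sup>2 \<le> (\<integral>\<omega>. (F \<omega>)\<^sup>2 \<partial>M) * (\<integral>\<omega>. (G \<omega>)\<^sup>2 \<partial>M)"
proof -
  define a b c where "a = (\<integral>\<omega>. (F \<omega>)\<^sup>2 \<partial>M)" and "b = (\<integral>\<omega>. F \<omega> * G \<omega> \<partial>M)"
    and "c = (\<integral>\<omega>. (G \<omega>)\<^sup>2 \<partial>M)"
  note [simp] = L2_integrable_mult[OF assms] L2_integrable_square[OF assms(1)]
    L2_integrable_square[OF assms(2)]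
  \<comment> \<open>This is E[(F - t G)^2]. For c > 0 its minimum, at t = b / c, is the claimed
    inequality; for c = 0 the function G vanishes almost everywhere.\<close>
  have quad: "0 \<le> a - 2 * t * b + t\<^sup>2 * c" for t
  proof -
    have "0 \<le> (\<integral>\<omega>. (F \<omega> - t * G \<omega>)\<^sup>2 \<partial>M)" by simp
    also have "\<dots> = (\<integral>\<omega>. (F \<omega>)\<^sup>2 - 2 * t * (F \<omega> * G \<omega>) + t\<^sup>2 * (G \<omega>)\<^sup>2 \<partial>M)"
      by (intro Bochner_Integration.integral_cong) (auto simp: power2_eq_square algebra_simps)
    also have "\<dots> = a - 2 * t * b + t\<^sup>2 * c"
      by (simp add: a_def b_def c_def)
    finally show ?thesis .
  qed
  have "b\<^sup>2 \<le> a * c"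
  proof (cases "c = 0")
    case True
    then have "AE \<omega> in M. (G \<omega>)\<^sup>2 = 0"
      unfolding c_def by (subst (asm) integral_nonneg_eq_0_iff_AE) auto
    then have "b = 0"
      unfolding b_def by (intro integral_eq_zero_AE) auto
    with True show ?thesis by simp
  next
    case False
    moreover have "c \<ge> 0" unfolding c_def by simp
    ultimately have "c > 0" by simp
    then show ?thesis
      using quad[of "b / c"] by (simp add: field_simps power2_eq_square)
  qed
  then show ?thesis by (simp add: a_def b_def c_def)
qed

text \<open>Stands in for Minkowski's inequality: (a + b)^2 \<le> 2 a^2 + 2 b^2 keeps the limit
  arguments in terms of squared norms.\<close>

lemma L2_triangle:
  assumes "F \<in> L2 M" "G \<in> L2 M"
  shows "(\<integral>\<omega>. (F \<omega> + G \<omega>)\<^sup>2 \<partial>M) \<le> 2 * (\<integral>\<omega>. (F \<omega>)\<^sup>2 \<partial>M) + 2 * (\<integral>\<omega>. (G \<omega>)\<^sup>2 \<partial>M)"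
proof -
  have "(\<integral>\<omega>. (F \<omega> + G \<omega>)\<^sup>2 \<partial>M) \<le> (\<integral>\<omega>. 2 * (F \<omega>)\<^sup>2 + 2 * (G \<omega>)\<^sup>2 \<partial>M)"
  proof (rule integral_mono)
    show "(F \<omega> + G \<omega>)\<^sup>2 \<le> 2 * (F \<omega>)\<^sup>2 + 2 * (G \<omega>)\<^sup>2" for \<omega>
      using sum_squares_bound[of "F \<omega>" "G \<omega>"] by (simp add: power2_sum)
  qed (use assms L2_add[OF assms] in \<open>auto simp: L2_def\<close>)
  then show ?thesis using assms by (simp add: L2_def)
qed

lemma L2_integral_sum_square_le:
  assumes "finite A" "\<And>i. i \<in> A \<Longrightarrow> F i \<in> L2 M"
  shows "(\<integral>\<omega>. (\<Sum>i\<in>A. F i \<omega>)\<^sup>2 \<partial>M) \<le> real (card A) * (\<Sum>i\<in>A. \<integral>\<omega>. (F i \<omega>)\<^sup>2 \<partial>M)"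
proof -
  have "(\<integral>\<omega>. (\<Sum>i\<in>A. F i \<omega>)\<^sup>2 \<partial>M) \<le> (\<integral>\<omega>. real (card A) * (\<Sum>i\<in>A. (F i \<omega>)\<^sup>2) \<partial>M)"
  proof (rule integral_mono)
    show "(\<Sum>i\<in>A. F i \<omega>)\<^sup>2 \<le> real (card A) * (\<Sum>i\<in>A. (F i \<omega>)\<^sup>2)" for \<omega>
      using sum_squared_le_sum_of_squares[of "\<lambda>i. F i \<omega>" A] assms(1)
      by (simp add: mult.commute)
  qed (use assms L2_sum[of A F M] in \<open>auto simp: L2_def\<close>)
  then show ?thesis using assms by (simp add: L2_def)
qed

lemma L2_tendstoD:
  assumes "L2_tendsto M S F A"
  shows "F \<in> L2 M" "\<forall>\<^sub>F i in A. S i \<in> L2 M" "((\<lambda>i. \<integral>\<omega>. (S i \<omega> - F \<omega>)\<^sup>2 \<partial>M) \<longlongrightarrow> 0) A"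
  using assms by (auto simp: L2_tendsto_def)

lemma L2_tendstoI_le:
  assumes "F \<in> L2 M" "\<forall>\<^sub>F i in A. S i \<in> L2 M" "(e \<longlongrightarrow> (0::real)) A"
    and "\<forall>\<^sub>F i in A. (\<integral>\<omega>. (S i \<omega> - F \<omega>)\<^sup>2 \<partial>M) \<le> e i"
  shows "L2_tendsto M S F A"
  unfolding L2_tendsto_def
  using assms(1,2) tendsto_sandwich[OF _ assms(4) tendsto_const assms(3)] by simp

lemma L2_tendsto_add:
  assumes S: "L2_tendsto M S F A" and T: "L2_tendsto M T G A"
  shows "L2_tendsto M (\<lambda>i \<omega>. S i \<omega> + T i \<omega>) (\<lambda>\<omega>. F \<omega> + G \<omega>) A"
proof (rule L2_tendstoI_le)
  have ev: "\<forall>\<^sub>F i in A. S i \<in> L2 M \<and> T i \<in> L2 M"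
    using L2_tendstoD(2)[OF S] L2_tendstoD(2)[OF T] by eventually_elim simp
  then show "\<forall>\<^sub>F i in A. (\<lambda>\<omega>. S i \<omega> + T i \<omega>) \<in> L2 M"
    by eventually_elim (simp add: L2_add)
  show "(\<lambda>\<omega>. F \<omega> + G \<omega>) \<in> L2 M"
    using L2_tendstoD(1)[OF S] L2_tendstoD(1)[OF T] by (rule L2_add)
  show "((\<lambda>i. 2 * (\<integral>\<omega>. (S i \<omega> - F \<omega>)\<^sup>2 \<partial>M) + 2 * (\<integral>\<omega>. (T i \<omega> - G \<omega>)\<^sup>2 \<partial>M)) \<longlongrightarrow> 0) A"
    using tendsto_add[OF tendsto_mult[OF tendsto_const[of 2] L2_tendstoD(3)[OF S]]
        tendsto_mult[OF tendsto_const[of 2] L2_tendstoD(3)[OF T]]] by simp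
  show "\<forall>\<^sub>F i in A. (\<integral>\<omega>. (S i \<omega> + T i \<omega> - (F \<omega> + G \<omega>))\<^sup>2 \<partial>M) \<le>
      2 * (\<integral>\<omega>. (S i \<omega> - F \<omega>)\<^sup>2 \<partial>M) + 2 * (\<integral>\<omega>. (T i \<omega> - G \<omega>)\<^sup>2 \<partial>M)"
    using ev
  proof eventually_elim
    case (elim i)
    have "(\<integral>\<omega>. (S i \<omega> + T i \<omega> - (F \<omega> + G \<omega>))\<^sup>2 \<partial>M)
        = (\<integral>\<omega>. ((S i \<omega> - F \<omega>) + (T i \<omega> - G \<omega>))\<^sup>2 \<partial>M)"
      by (simp add: algebra_simps)
    also have "\<dots> \<le> 2 * (\<integral>\<omega>. (S i \<omega> - F \<omega>)\<^sup>2 \<partial>M) + 2 * (\<integral>\<omega>. (T i \<omega> - G \<omega>)\<^sup>2 \<partial>M)"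
      using elim L2_tendstoD(1)[OF S] L2_tendstoD(1)[OF T] by (intro L2_triangle L2_diff) auto
    finally show ?case .
  qed
qed

lemma L2_tendsto_cmult:
  assumes S: "L2_tendsto M S F A"
  shows "L2_tendsto M (\<lambda>i \<omega>. a * S i \<omega>) (\<lambda>\<omega>. a * F \<omega>) A"
  unfolding L2_tendsto_def
proof (intro conjI)
  show "(\<lambda>\<omega>. a * F \<omega>) \<in> L2 M" using L2_tendstoD(1)[OF S] by (rule L2_cmult)
  show "\<forall>\<^sub>F i in A. (\<lambda>\<omega>. a * S i \<omega>) \<in> L2 M"
    using L2_tendstoD(2)[OF S] by eventually_elim (rule L2_cmult)
  have "(\<integral>\<omega>. (a * S i \<omega> - a * F \<omega>)\<^sup>2 \<partial>M) = a\<^sup>2 * (\<integral>\<omega>. (S i \<omega> - F \<omega>)\<^sup>2 \<partial>M)" for i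
    by (simp add: power_mult_distrib flip: right_diff_distrib)
  then show "((\<lambda>i. \<integral>\<omega>. (a * S i \<omega> - a * F \<omega>)\<^sup>2 \<partial>M) \<longlongrightarrow> 0) A"
    using tendsto_mult[OF tendsto_const[of "a\<^sup>2"] L2_tendstoD(3)[OF S]] by simp
qed

lemma L2_tendsto_diff:
  assumes "L2_tendsto M S F A" "L2_tendsto M T G A"
  shows "L2_tendsto M (\<lambda>i \<omega>. S i \<omega> - T i \<omega>) (\<lambda>\<omega>. F \<omega> - G \<omega>) A"
  using L2_tendsto_add[OF assms(1) L2_tendsto_cmult[OF assms(2), of "- 1"]] by simp

text \<open>Used to pass from convergence over all finite index sets to convergence of the partial
  sums over \<open>{..<N}\<close>, the form in which \<open>L2_sums\<close> is stated.\<close>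

lemma L2_tendsto_filterlim:
  assumes "L2_tendsto M S F A" "filterlim h A B"
  shows "L2_tendsto M (\<lambda>i. S (h i)) F B"
  using assms filterlim_compose[OF L2_tendstoD(3)[OF assms(1)] assms(2)]
    eventually_compose_filterlim[OF L2_tendstoD(2)[OF assms(1)] assms(2)]
  by (simp add: L2_tendsto_def)

lemma L2_tendsto_cong_AE:
  assumes S: "L2_tendsto M S F A" and T: "\<And>i. T i \<in> borel_measurable M"
    and eq: "\<And>i. AE \<omega> in M. T i \<omega> = S i \<omega>"
  shows "L2_tendsto M T F A"
proof (rule L2_tendstoI_le)
  show "F \<in> L2 M" "((\<lambda>i. \<integral>\<omega>. (S i \<omega> - F \<omega>)\<^sup>2 \<partial>M) \<longlongrightarrow> 0) A"
    using L2_tendstoD[OF S] by auto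
  show "\<forall>\<^sub>F i in A. T i \<in> L2 M"
    using L2_tendstoD(2)[OF S] by eventually_elim (rule L2_cong_AE[OF _ T eq])
  show "\<forall>\<^sub>F i in A. (\<integral>\<omega>. (T i \<omega> - F \<omega>)\<^sup>2 \<partial>M) \<le> (\<integral>\<omega>. (S i \<omega> - F \<omega>)\<^sup>2 \<partial>M)"
    using L2_tendstoD(2)[OF S]
  proof eventually_elim
    case (elim i)
    have "(\<integral>\<omega>. (T i \<omega> - F \<omega>)\<^sup>2 \<partial>M) = (\<integral>\<omega>. (S i \<omega> - F \<omega>)\<^sup>2 \<partial>M)"
      using elim T[of i] L2_tendstoD(1)[OF S] eq[of i]
      by (intro integral_cong_AE) (auto simp: L2_def)
    then show ?case by simp
  qed
qed

lemma L2_tendsto_inner: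
  assumes S: "L2_tendsto M S F A" and G: "G \<in> L2 M"
  shows "((\<lambda>i. \<integral>\<omega>. S i \<omega> * G \<omega> \<partial>M) \<longlongrightarrow> (\<integral>\<omega>. F \<omega> * G \<omega> \<partial>M)) A"
proof (rule Lim_transform)
  show "((\<lambda>i. \<integral>\<omega>. F \<omega> * G \<omega> \<partial>M) \<longlongrightarrow> (\<integral>\<omega>. F \<omega> * G \<omega> \<partial>M)) A" by simp
  have "\<forall>\<^sub>F i in A. \<bar>(\<integral>\<omega>. S i \<omega> * G \<omega> \<partial>M) - (\<integral>\<omega>. F \<omega> * G \<omega> \<partial>M)\<bar>
      \<le> sqrt ((\<integral>\<omega>. (S i \<omega> - F \<omega>)\<^sup>2 \<partial>M) * (\<integral>\<omega>. (G \<omega>)\<^sup>2 \<partial>M))"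
    using L2_tendstoD(2)[OF S]
  proof eventually_elim
    case (elim i)
    note [simp] = L2_integrable_mult[OF elim G] L2_integrable_mult[OF L2_tendstoD(1)[OF S] G]
    have "(\<integral>\<omega>. (S i \<omega> - F \<omega>) * G \<omega> \<partial>M) = (\<integral>\<omega>. S i \<omega> * G \<omega> \<partial>M) - (\<integral>\<omega>. F \<omega> * G \<omega> \<partial>M)"
      by (simp add: left_diff_distrib)
    then have "((\<integral>\<omega>. S i \<omega> * G \<omega> \<partial>M) - (\<integral>\<omega>. F \<omega> * G \<omega> \<partial>M))\<^sup>2
        \<le> (\<integral>\<omega>. (S i \<omega> - F \<omega>)\<^sup>2 \<partial>M) * (\<integral>\<omega>. (G \<omega>)\<^sup>2 \<partial>M)"
      using L2_Cauchy_Schwarz[OF L2_diff[OF elim L2_tendstoD(1)[OF S]] G]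
      by simp
    then show ?case by (metis real_sqrt_abs real_sqrt_le_mono)
  qed
  moreover have "((\<lambda>i. sqrt ((\<integral>\<omega>. (S i \<omega> - F \<omega>)\<^sup>2 \<partial>M) * (\<integral>\<omega>. (G \<omega>)\<^sup>2 \<partial>M))) \<longlongrightarrow> 0) A"
    using tendsto_real_sqrt[OF tendsto_mult[OF L2_tendstoD(3)[OF S] tendsto_const]] by simp
  ultimately show "((\<lambda>i. (\<integral>\<omega>. S i \<omega> * G \<omega> \<partial>M) - (\<integral>\<omega>. F \<omega> * G \<omega> \<partial>M)) \<longlongrightarrow> 0) A"
    unfolding real_norm_def[symmetric] by (rule Lim_null_comparison)
qed

text \<open>Expanding a square gives E[S^2] = E[(S - F)^2] + 2 E[S F] - E[F^2], where the limits of
  the terms on the right are known.\<close>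

lemma L2_tendsto_integral_square:
  assumes S: "L2_tendsto M S F A"
  shows "((\<lambda>i. \<integral>\<omega>. (S i \<omega>)\<^sup>2 \<partial>M) \<longlongrightarrow> (\<integral>\<omega>. (F \<omega>)\<^sup>2 \<partial>M)) A"
proof -
  have F: "F \<in> L2 M" using L2_tendstoD(1)[OF S] .
  have "((\<lambda>i. (\<integral>\<omega>. (S i \<omega> - F \<omega>)\<^sup>2 \<partial>M) + 2 * (\<integral>\<omega>. S i \<omega> * F \<omega> \<partial>M) - (\<integral>\<omega>. (F \<omega>)\<^sup>2 \<partial>M))
      \<longlongrightarrow> 0 + 2 * (\<integral>\<omega>. F \<omega> * F \<omega> \<partial>M) - (\<integral>\<omega>. (F \<omega>)\<^sup>2 \<partial>M)) A"
    by (intro tendsto_intros L2_tendstoD(3)[OF S] L2_tendsto_inner[OF S F])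
  moreover have "\<forall>\<^sub>F i in A. (\<integral>\<omega>. (S i \<omega> - F \<omega>)\<^sup>2 \<partial>M) + 2 * (\<integral>\<omega>. S i \<omega> * F \<omega> \<partial>M)
      - (\<integral>\<omega>. (F \<omega>)\<^sup>2 \<partial>M) = (\<integral>\<omega>. (S i \<omega>)\<^sup>2 \<partial>M)"
    using L2_tendstoD(2)[OF S]
  proof eventually_elim
    case (elim i)
    have "(\<integral>\<omega>. (S i \<omega> - F \<omega>)\<^sup>2 \<partial>M)
        = (\<integral>\<omega>. (S i \<omega>)\<^sup>2 - 2 * (S i \<omega> * F \<omega>) + (F \<omega>)\<^sup>2 \<partial>M)"
      by (intro Bochner_Integration.integral_cong) (auto simp: power2_diff)
    also have "\<dots> = (\<integral>\<omega>. (S i \<omega>)\<^sup>2 \<partial>M) - 2 * (\<integral>\<omega>. S i \<omega> * F \<omega> \<partial>M) + (\<integral>\<omega>. (F \<omega>)\<^sup>2 \<partial>M)"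
      using L2_integrable_mult[OF elim F] L2_integrable_square[OF elim] L2_integrable_square[OF F]
      by simp
    finally show ?case by simp
  qed
  ultimately show ?thesis
    using tendsto_cong by (force simp: power2_eq_square)
qed

lemma L2_tendsto_unique:
  assumes "L2_tendsto M S F A" "L2_tendsto M S G A" "A \<noteq> bot"
  shows "AE \<omega> in M. F \<omega> = G \<omega>"
proof -
  \<comment> \<open>The differences of the approximants are identically zero, so the constant 0
    converges to the squared norm of F - G.\<close>
  have "L2_tendsto M (\<lambda>i \<omega>. S i \<omega> - S i \<omega>) (\<lambda>\<omega>. F \<omega> - G \<omega>) A"
    by (rule L2_tendsto_diff) fact+
  from L2_tendsto_integral_square[OF this]
  have "((\<lambda>i. 0) \<longlongrightarrow> (\<integral>\<omega>. (F \<omega> - G \<omega>)\<^sup>2 \<partial>M)) A" by simp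
  then have "(\<integral>\<omega>. (F \<omega> - G \<omega>)\<^sup>2 \<partial>M) = 0"
    using tendsto_unique[OF assms(3)] tendsto_const by metis
  moreover have "integrable M (\<lambda>\<omega>. (F \<omega> - G \<omega>)\<^sup>2)"
    using L2_diff[OF L2_tendstoD(1)[OF assms(1)] L2_tendstoD(1)[OF assms(2)]]
    by (rule L2_integrable_square)
  ultimately have "AE \<omega> in M. (F \<omega> - G \<omega>)\<^sup>2 = 0"
    by (subst (asm) integral_nonneg_eq_0_iff_AE) auto
  then show ?thesis by eventually_elim simp
qed

section \<open>Completeness and unconditional convergence over a probability space\<close>

lemma (in prob_space) L2_const [simp]: "(\<lambda>_. c) \<in> L2 M"
  by (simp add: L2_def)

lemma (in prob_space) L2_integrable: "F \<in> L2 M \<Longrightarrow> integrable M F"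
  using L2_integrable_mult[of F M "\<lambda>_. 1"] by simp

text \<open>The Riesz-Fischer argument: a subsequence converges almost everywhere, and Fatou's lemma
  along it carries the Cauchy estimate over to the pointwise limit.\<close>

lemma (in prob_space) L2_complete:
  fixes S :: "nat \<Rightarrow> 'a \<Rightarrow> real"
  assumes S: "\<And>n. S n \<in> L2 M"
    and Cauchy: "\<And>e. e > 0 \<Longrightarrow> \<exists>N. \<forall>m\<ge>N. \<forall>n\<ge>N. (\<integral>\<omega>. (S m \<omega> - S n \<omega>)\<^sup>2 \<partial>M) < e"
  obtains F where "L2_tendsto M S F sequentially"
proof -
  have [measurable]: "S n \<in> borel_measurable M" for n
    using S by (rule L2_measurable)
  \<comment> \<open>On a probability space the Cauchy-Schwarz inequality with the constant 1 bounds
    the L1 distance by the L2 distance. Being Cauchy in L1 supplies the almost everywhere convergent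
    subsequence.\<close>
  have "\<exists>N. \<forall>i\<ge>N. \<forall>j\<ge>N. (\<integral>\<omega>. norm (S i \<omega> - S j \<omega>) \<partial>M) < e" if "e > 0" for e
  proof -
    obtain N where N: "\<And>m n. m \<ge> N \<Longrightarrow> n \<ge> N \<Longrightarrow> (\<integral>\<omega>. (S m \<omega> - S n \<omega>)\<^sup>2 \<partial>M) < e\<^sup>2"
      using Cauchy[of "e\<^sup>2"] \<open>e > 0\<close> by auto
    have "(\<integral>\<omega>. norm (S i \<omega> - S j \<omega>) \<partial>M) < e" if "i \<ge> N" "j \<ge> N" for i j
    proof -
      have "(\<lambda>\<omega>. \<bar>S i \<omega> - S j \<omega>\<bar>) \<in> L2 M"
        using L2_diff[OF S[of i] S[of j]] by (auto simp: L2_def)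
      from L2_Cauchy_Schwarz[OF this L2_const[of 1]]
      have "(\<integral>\<omega>. \<bar>S i \<omega> - S j \<omega>\<bar> \<partial>M)\<^sup>2 \<le> (\<integral>\<omega>. (S i \<omega> - S j \<omega>)\<^sup>2 \<partial>M)"
        by (simp add: prob_space)
      also have "\<dots> < e\<^sup>2" using N that by blast
      finally show ?thesis
        using \<open>e > 0\<close> by (simp add: power_less_imp_less_base)
    qed
    then show ?thesis by blast
  qed
  then obtain r where r: "strict_mono r" "AE \<omega> in M. Cauchy (\<lambda>i. S (r i) \<omega>)"
    using cauchy_L1_AE_cauchy_subseq[of M S] L2_integrable[OF S] by blast
  define F where "F \<omega> = lim (\<lambda>i. S (r i) \<omega>)" for \<omega>
  have [measurable]: "F \<in> borel_measurable M"
    unfolding F_def by measurable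
  have lim: "AE \<omega> in M. (\<lambda>i. S (r i) \<omega>) \<longlonglongrightarrow> F \<omega>"
    using r(2) by eventually_elim (simp add: F_def Cauchy_convergent_iff convergent_LIMSEQ_iff)
  have bound: "(\<integral>\<^sup>+\<omega>. ennreal ((S n \<omega> - F \<omega>)\<^sup>2) \<partial>M) \<le> ennreal e"
    if N: "\<And>m n. m \<ge> N \<Longrightarrow> n \<ge> N \<Longrightarrow> (\<integral>\<omega>. (S m \<omega> - S n \<omega>)\<^sup>2 \<partial>M) < e" and "n \<ge> N" for N n e
  proof -
    have "(\<integral>\<^sup>+\<omega>. ennreal ((S n \<omega> - F \<omega>)\<^sup>2) \<partial>M)
        = (\<integral>\<^sup>+\<omega>. liminf (\<lambda>i. ennreal ((S n \<omega> - S (r i) \<omega>)\<^sup>2)) \<partial>M)"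
    proof (rule nn_integral_cong_AE)
      show "AE \<omega> in M. ennreal ((S n \<omega> - F \<omega>)\<^sup>2)
          = liminf (\<lambda>i. ennreal ((S n \<omega> - S (r i) \<omega>)\<^sup>2))"
        using lim
      proof eventually_elim
        case (elim \<omega>)
        then have "(\<lambda>i. ennreal ((S n \<omega> - S (r i) \<omega>)\<^sup>2)) \<longlonglongrightarrow> ennreal ((S n \<omega> - F \<omega>)\<^sup>2)"
          by (intro tendsto_intros)
        then show ?case
          by (intro lim_imp_Liminf[symmetric]) simp_all
      qed
    qed
    also have "\<dots> \<le> liminf (\<lambda>i. \<integral>\<^sup>+\<omega>. ennreal ((S n \<omega> - S (r i) \<omega>)\<^sup>2) \<partial>M)"
      by (rule nn_integral_liminf) measurable
    also have "\<dots> \<le> ennreal e"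
    proof (rule Liminf_le)
      have "\<forall>\<^sub>F i in sequentially. r i \<ge> N"
        by (intro eventually_sequentiallyI[of N]) (meson order_trans seq_suble[OF r(1)])
      then show "\<forall>\<^sub>F i in sequentially. (\<integral>\<^sup>+\<omega>. ennreal ((S n \<omega> - S (r i) \<omega>)\<^sup>2) \<partial>M) \<le> ennreal e"
      proof eventually_elim
        case (elim i)
        have "(\<integral>\<^sup>+\<omega>. ennreal ((S n \<omega> - S (r i) \<omega>)\<^sup>2) \<partial>M)
            = ennreal (\<integral>\<omega>. (S n \<omega> - S (r i) \<omega>)\<^sup>2 \<partial>M)"
          by (intro nn_integral_eq_integral L2_integrable_square L2_diff S) auto
        then show ?case
          using N[OF \<open>n \<ge> N\<close> elim] by (simp add: ennreal_leI)
      qed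
    qed simp
    finally show ?thesis .
  qed
  have sq: "integrable M (\<lambda>\<omega>. (S n \<omega> - F \<omega>)\<^sup>2)" "(\<integral>\<omega>. (S n \<omega> - F \<omega>)\<^sup>2 \<partial>M) \<le> e"
    if "\<And>m n. m \<ge> N \<Longrightarrow> n \<ge> N \<Longrightarrow> (\<integral>\<omega>. (S m \<omega> - S n \<omega>)\<^sup>2 \<partial>M) < e" and "n \<ge> N" and "e > 0" for N n e
  proof -
    note b = bound[OF that(1,2)]
    show "integrable M (\<lambda>\<omega>. (S n \<omega> - F \<omega>)\<^sup>2)"
      by (rule integrableI_nonneg) (use b in \<open>auto simp: le_less_trans\<close>)
    then have "(\<integral>\<^sup>+\<omega>. ennreal ((S n \<omega> - F \<omega>)\<^sup>2) \<partial>M) = ennreal (\<integral>\<omega>. (S n \<omega> - F \<omega>)\<^sup>2 \<partial>M)"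
      by (intro nn_integral_eq_integral) auto
    with b \<open>e > 0\<close> show "(\<integral>\<omega>. (S n \<omega> - F \<omega>)\<^sup>2 \<partial>M) \<le> e"
      by (simp add: ennreal_le_iff)
  qed
  have "F \<in> L2 M"
  proof -
    obtain N where N: "\<And>m n. m \<ge> N \<Longrightarrow> n \<ge> N \<Longrightarrow> (\<integral>\<omega>. (S m \<omega> - S n \<omega>)\<^sup>2 \<partial>M) < 1"
      using Cauchy[of 1] by auto
    have "(\<lambda>\<omega>. S N \<omega> - F \<omega>) \<in> L2 M"
      using sq(1)[OF N order_refl] by (auto simp: L2_def)
    from L2_diff[OF S[of N] this] show ?thesis by simp
  qed
  moreover have "(\<lambda>n. \<integral>\<omega>. (S n \<omega> - F \<omega>)\<^sup>2 \<partial>M) \<longlonglongrightarrow> 0"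
  proof (rule LIMSEQ_I)
    fix e :: real assume "e > 0"
    then obtain N where N: "\<And>m n. m \<ge> N \<Longrightarrow> n \<ge> N \<Longrightarrow> (\<integral>\<omega>. (S m \<omega> - S n \<omega>)\<^sup>2 \<partial>M) < e / 2"
      using Cauchy[of "e / 2"] by auto
    have "(\<integral>\<omega>. (S n \<omega> - F \<omega>)\<^sup>2 \<partial>M) < e" if "n \<ge> N" for n
      using sq(2)[OF N that] \<open>e > 0\<close> by simp
    then show "\<exists>no. \<forall>n\<ge>no. norm ((\<integral>\<omega>. (S n \<omega> - F \<omega>)\<^sup>2 \<partial>M) - 0) < e"
      by auto
  qed
  ultimately show thesis
    using that S by (auto simp: L2_tendsto_def)
qed

lemma summable_on_nonneg_tail:
  fixes h :: "'i \<Rightarrow> real"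
  assumes "h summable_on I" "\<And>i. i \<in> I \<Longrightarrow> 0 \<le> h i" "e > 0"
  obtains B where "finite B" "B \<subseteq> I"
    "\<And>A. finite A \<Longrightarrow> A \<subseteq> I \<Longrightarrow> A \<inter> B = {} \<Longrightarrow> sum h A < e"
proof -
  have "(sum h \<longlongrightarrow> infsum h I) (finite_subsets_at_top I)"
    using assms(1) by (simp add: has_sum_infsum flip: has_sum_def)
  then have "\<forall>\<^sub>F B in finite_subsets_at_top I. dist (sum h B) (infsum h I) < e"
    using \<open>e > 0\<close> by (rule tendstoD)
  then obtain B where "finite B \<and> B \<subseteq> I \<and>
      (\<forall>C. finite C \<and> B \<subseteq> C \<and> C \<subseteq> I \<longrightarrow> dist (sum h C) (infsum h I) < e)"
    unfolding eventually_finite_subsets_at_top by (elim exE)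
  then have B: "finite B" "B \<subseteq> I"
    and *: "\<And>C. finite C \<Longrightarrow> B \<subseteq> C \<Longrightarrow> C \<subseteq> I \<Longrightarrow> dist (sum h C) (infsum h I) < e"
    by auto
  have "sum h A < e" if A: "finite A" "A \<subseteq> I" "A \<inter> B = {}" for A
  proof -
    have "sum h A + sum h B = sum h (A \<union> B)"
      using A B by (simp add: sum.union_disjoint)
    also have "\<dots> \<le> infsum h I"
      using assms(1,2) A B by (intro finite_sum_le_infsum) auto
    also have "\<dots> < sum h B + e"
      using *[OF B(1) order_refl B(2)] by (simp add: dist_real_def abs_less_iff)
    finally show ?thesis by simp
  qed
  with B that show thesis by blast
qed

text \<open>Applied to blocks disjoint from a large finite set, the bound makes the net of partial
  sums Cauchy. Completeness is available for sequences, so a limit is found along the sets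
  \<open>B n\<close> and then shown to be the limit over all finite subsets.\<close>

lemma (in prob_space) L2_unconditional_convergence:
  fixes g :: "'i \<Rightarrow> 'a \<Rightarrow> real"
  assumes g: "\<And>i. i \<in> I \<Longrightarrow> g i \<in> L2 M"
    and h: "h summable_on I" "\<And>i. i \<in> I \<Longrightarrow> 0 \<le> h i"
    and bound: "\<And>A. finite A \<Longrightarrow> A \<subseteq> I \<Longrightarrow> (\<integral>\<omega>. (\<Sum>i\<in>A. g i \<omega>)\<^sup>2 \<partial>M) \<le> sum h A"
  obtains F where "L2_tendsto M (\<lambda>A \<omega>. \<Sum>i\<in>A. g i \<omega>) F (finite_subsets_at_top I)"
proof -
  have "\<exists>B. finite B \<and> B \<subseteq> I \<and>
      (\<forall>A. finite A \<longrightarrow> A \<subseteq> I \<longrightarrow> A \<inter> B = {} \<longrightarrow> sum h A < inverse (real (Suc n)))" for n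
    using summable_on_nonneg_tail[OF h, of "inverse (real (Suc n))"]
    by (metis inverse_positive_iff_positive of_nat_0_less_iff zero_less_Suc)
  then obtain B0 where B0: "\<And>n. finite (B0 n)" "\<And>n. B0 n \<subseteq> I"
    "\<And>n A. finite A \<Longrightarrow> A \<subseteq> I \<Longrightarrow> A \<inter> B0 n = {} \<Longrightarrow> sum h A < inverse (real (Suc n))"
    by metis
  \<comment> \<open>Unions make the sets increasing, as the Cauchy estimate compares
    \<open>B m\<close> with a smaller \<open>B n\<close>; a set disjoint from \<open>B n\<close> is
    still disjoint from \<open>B0 n\<close>.\<close>
  define B where "B n = (\<Union>m\<le>n. B0 m)" for n
  have B: "finite (B n)" "B n \<subseteq> I" for n
    using B0 by (auto simp: B_def)
  have gap: "(\<integral>\<omega>. ((\<Sum>i\<in>C. g i \<omega>) - (\<Sum>i\<in>B n. g i \<omega>))\<^sup>2 \<partial>M) < inverse (real (Suc n))"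
    if "finite C" "B n \<subseteq> C" "C \<subseteq> I" for C n
  proof -
    have "(\<Sum>i\<in>C. g i \<omega>) - (\<Sum>i\<in>B n. g i \<omega>) = (\<Sum>i\<in>C - B n. g i \<omega>)" for \<omega>
      using that by (simp add: sum_diff)
    then have "(\<integral>\<omega>. ((\<Sum>i\<in>C. g i \<omega>) - (\<Sum>i\<in>B n. g i \<omega>))\<^sup>2 \<partial>M) \<le> sum h (C - B n)"
      using that bound[of "C - B n"] by auto
    also have "\<dots> < inverse (real (Suc n))"
      using that by (intro B0(3)) (auto simp: B_def)
    finally show ?thesis .
  qed
  have S: "(\<lambda>\<omega>. \<Sum>i\<in>C. g i \<omega>) \<in> L2 M" if "C \<subseteq> I" for C
    using that g by (intro L2_sum) auto
  have Cauchy: "\<exists>N. \<forall>m\<ge>N. \<forall>n\<ge>N. (\<integral>\<omega>. ((\<Sum>i\<in>B m. g i \<omega>) - (\<Sum>i\<in>B n. g i \<omega>))\<^sup>2 \<partial>M) < e" if "e > 0" for e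
  proof -
    obtain N where N: "inverse (real (Suc N)) < e"
      using reals_Archimedean \<open>e > 0\<close> by blast
    have mono: "(\<integral>\<omega>. ((\<Sum>i\<in>B m. g i \<omega>) - (\<Sum>i\<in>B n. g i \<omega>))\<^sup>2 \<partial>M) < e" if "n \<ge> N" "m \<ge> n" for m n
    proof -
      have "B n \<subseteq> B m" using that by (force simp: B_def)
      then have "(\<integral>\<omega>. ((\<Sum>i\<in>B m. g i \<omega>) - (\<Sum>i\<in>B n. g i \<omega>))\<^sup>2 \<partial>M) < inverse (real (Suc n))"
        using B by (intro gap) auto
      also have "\<dots> \<le> inverse (real (Suc N))" using that by simp
      finally show ?thesis using N by simp
    qed
    then have "(\<integral>\<omega>. ((\<Sum>i\<in>B m. g i \<omega>) - (\<Sum>i\<in>B n. g i \<omega>))\<^sup>2 \<partial>M) < e" if "n \<ge> N" "m \<ge> N" for m n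
      using that mono[of n m] mono[of m n] by (cases "m \<ge> n") (auto simp: power2_commute)
    then show ?thesis by blast
  qed
  obtain F where F: "L2_tendsto M (\<lambda>n \<omega>. \<Sum>i\<in>B n. g i \<omega>) F sequentially"
    by (rule L2_complete[OF S[OF B(2)] Cauchy])
  have "((\<lambda>A. \<integral>\<omega>. ((\<Sum>i\<in>A. g i \<omega>) - F \<omega>)\<^sup>2 \<partial>M) \<longlongrightarrow> 0) (finite_subsets_at_top I)"
  proof (rule order_tendstoI)
    show "\<forall>\<^sub>F A in finite_subsets_at_top I. a < (\<integral>\<omega>. ((\<Sum>i\<in>A. g i \<omega>) - F \<omega>)\<^sup>2 \<partial>M)"
      if "a < 0" for a
      using that by (intro always_eventually allI less_le_trans[OF that]) simp
    fix e :: real assume "0 < e"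
    \<comment> \<open>The two terms are those of \<open>L2_triangle\<close> on the way from the sum
      over C through the sum over \<open>B n\<close> to F.\<close>
    have "(\<lambda>n. 2 * inverse (real (Suc n)) + 2 * (\<integral>\<omega>. ((\<Sum>i\<in>B n. g i \<omega>) - F \<omega>)\<^sup>2 \<partial>M)) \<longlonglongrightarrow> 2 * 0 + 2 * 0"
      by (intro tendsto_intros L2_tendstoD(3)[OF F] LIMSEQ_inverse_real_of_nat)
    then have "\<forall>\<^sub>F n in sequentially.
        2 * inverse (real (Suc n)) + 2 * (\<integral>\<omega>. ((\<Sum>i\<in>B n. g i \<omega>) - F \<omega>)\<^sup>2 \<partial>M) < e"
      using \<open>0 < e\<close> by (intro order_tendstoD) auto
    then obtain n where n: "2 * inverse (real (Suc n)) + 2 * (\<integral>\<omega>. ((\<Sum>i\<in>B n. g i \<omega>) - F \<omega>)\<^sup>2 \<partial>M) < e"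
      unfolding eventually_sequentially by blast
    have "(\<integral>\<omega>. ((\<Sum>i\<in>C. g i \<omega>) - F \<omega>)\<^sup>2 \<partial>M) < e" if "finite C" "B n \<subseteq> C" "C \<subseteq> I" for C
    proof -
      have "(\<integral>\<omega>. ((\<Sum>i\<in>C. g i \<omega>) - F \<omega>)\<^sup>2 \<partial>M)
          = (\<integral>\<omega>. (((\<Sum>i\<in>C. g i \<omega>) - (\<Sum>i\<in>B n. g i \<omega>)) + ((\<Sum>i\<in>B n. g i \<omega>) - F \<omega>))\<^sup>2 \<partial>M)"
        by simp
      also have "\<dots> \<le> 2 * (\<integral>\<omega>. ((\<Sum>i\<in>C. g i \<omega>) - (\<Sum>i\<in>B n. g i \<omega>))\<^sup>2 \<partial>M)
          + 2 * (\<integral>\<omega>. ((\<Sum>i\<in>B n. g i \<omega>) - F \<omega>)\<^sup>2 \<partial>M)"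
        using that B by (intro L2_triangle L2_diff S L2_tendstoD(1)[OF F]) auto
      also have "\<dots> < e" using n gap[OF that] by simp
      finally show ?thesis .
    qed
    then show "\<forall>\<^sub>F A in finite_subsets_at_top I. (\<integral>\<omega>. ((\<Sum>i\<in>A. g i \<omega>) - F \<omega>)\<^sup>2 \<partial>M) < e"
      unfolding eventually_finite_subsets_at_top by (intro exI[of _ "B n"]) (simp add: B)
  qed
  moreover have "\<forall>\<^sub>F A in finite_subsets_at_top I. (\<lambda>\<omega>. \<Sum>i\<in>A. g i \<omega>) \<in> L2 M"
    by (intro eventually_finite_subsets_at_top_weakI S)
  ultimately show thesis
    using that L2_tendstoD(1)[OF F] by (auto simp: L2_tendsto_def)
qed

section \<open>The Bernoulli space\<close>

lemma space_sign_law [simp]: "space (sign_law a) = {-1, 1}"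
  and sets_sign_law [simp]: "sets (sign_law a) = Pow {-1, 1}"
  by (simp_all add: sign_law_def space_point_measure sets_point_measure)

lemma prob_space_sign_law:
  assumes "0 < a" "a < 1"
  shows "prob_space (sign_law a)"
proof
  show "emeasure (sign_law a) (space (sign_law a)) = 1"
    using assms unfolding sign_law_def
    by (simp add: emeasure_point_measure_finite space_point_measure flip: ennreal_plus)
qed

text \<open>As 0 < a < 1, both points carry positive mass. This is why almost sure statements
  survive fixing a coordinate at either value.\<close>

lemma AE_sign_law:
  assumes "0 < a" "a < 1"
  shows "(AE x in sign_law a. Q x) \<longleftrightarrow> Q 1 \<and> Q (-1)"
  using assms unfolding sign_law_def point_measure_def
  by (subst AE_density) (auto simp: AE_count_space)

lemma integral_sign_law:
  fixes g :: "real \<Rightarrow> real"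
  assumes "0 < a" "a < 1"
  shows "(\<integral>x. g x \<partial>sign_law a) = a * g 1 + (1 - a) * g (-1)"
  using assms unfolding sign_law_def
  by (subst lebesgue_integral_point_measure_finite) auto

text \<open>Independence of coordinate k is stated pointwise and for every real x, so that the rules
  for \<open>grad\<close> and \<open>cond_mean\<close> hold at every point, without exceptional null
  sets.\<close>

definition free_of :: "nat \<Rightarrow> ((nat \<Rightarrow> real) \<Rightarrow> real) \<Rightarrow> bool" where
  "free_of k Z \<longleftrightarrow> (\<forall>w x. Z (w(k := x)) = Z w)"

lemma free_ofD: "free_of k Z \<Longrightarrow> Z (w(k := x)) = Z w"
  by (simp add: free_of_def)

lemma free_of_Y: "k \<noteq> l \<Longrightarrow> free_of k (Y p l)"
  by (simp add: free_of_def Y_def)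

definition cond_mean :: "(nat \<Rightarrow> real) \<Rightarrow> nat \<Rightarrow> ((nat \<Rightarrow> real) \<Rightarrow> real) \<Rightarrow> (nat \<Rightarrow> real) \<Rightarrow> real" where
  "cond_mean p k F w = p k * F (w(k := 1)) + q_of p k * F (w(k := -1))"

lemma free_of_grad_self: "free_of k (grad p k F)"
  by (simp add: free_of_def grad_def)

lemma free_of_cond_mean_self: "free_of k (cond_mean p k F)"
  by (simp add: free_of_def cond_mean_def)

lemma free_of_grad: "free_of l F \<Longrightarrow> free_of l (grad p k F)"
  by (cases "l = k") (auto simp: free_of_def grad_def fun_upd_twist[of l k])

lemma free_of_cond_mean: "free_of l F \<Longrightarrow> free_of l (cond_mean p k F)"
  by (cases "l = k") (auto simp: free_of_def cond_mean_def fun_upd_twist[of l k])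

lemma grad_mult_free: "free_of k Z \<Longrightarrow> grad p k (\<lambda>w. F w * Z w) = (\<lambda>w. grad p k F w * Z w)"
  by (auto simp: grad_def free_of_def algebra_simps)

lemma grad_free: "free_of k Z \<Longrightarrow> grad p k Z = (\<lambda>_. 0)"
  by (auto simp: grad_def free_of_def)

lemma grad_cond_mean: "k \<noteq> l \<Longrightarrow> grad p l (cond_mean p k F) = cond_mean p k (grad p l F)"
  by (auto simp: grad_def cond_mean_def fun_upd_twist algebra_simps)

lemma grad_sum: "grad p k (\<lambda>w. \<Sum>i\<in>A. F i w) w = (\<Sum>i\<in>A. grad p k (F i) w)"
  by (simp add: grad_def sum_subtractf flip: sum_distrib_left)

lemma grad_cmult: "grad p k (\<lambda>w. a * F w) w = a * grad p k F w"
  by (simp add: grad_def algebra_simps)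

lemma grad_add: "grad p k (\<lambda>w. F w + G w) w = grad p k F w + grad p k G w"
  by (simp add: grad_def algebra_simps)

lemma grad_diff: "grad p k (\<lambda>w. F w - G w) w = grad p k F w - grad p k G w"
  by (simp add: grad_def algebra_simps)

text \<open>The right-hand sides are the two values q / s and - p / s of Y, where s is the square
  root of p q.\<close>

lemma two_point_identities:
  fixes a s :: real
  shows "((1 - a) - a + 1) / (2 * s) = (1 - a) / s" "((1 - a) - a + - 1) / (2 * s) = - a / s"
proof -
  have "(1 - a) - a + 1 = 2 * (1 - a)" "(1 - a) - a + - 1 = 2 * (- a)" by simp_all
  then show "((1 - a) - a + 1) / (2 * s) = (1 - a) / s"
    "((1 - a) - a + - 1) / (2 * s) = - a / s"
    by (simp_all only: mult_divide_mult_cancel_left_if) simp_all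
qed

text \<open>The two admissible values of y have sum ((1 - a) - a) / s and product -1, hence are the
  roots of this quadratic equation.\<close>

lemma two_point_square:
  fixes a s :: real
  assumes "0 < s" "s * s = a * (1 - a)" "y = (1 - a) / s \<or> y = - a / s"
  shows "y\<^sup>2 = 1 + ((1 - a) - a) / s * y"
proof -
  have "(y * s)\<^sup>2 = s * s + ((1 - a) - a) * (y * s)"
  proof -
    have "y * s = 1 - a \<or> y * s = - a"
      using assms(1,3) by auto
    then show ?thesis
      unfolding assms(2)
      by (elim disjE; simp only: power2_eq_square; simp add: algebra_simps)
  qed
  moreover have "y\<^sup>2 = (y * s)\<^sup>2 / (s * s)"
    using assms(1) by (simp add: power2_eq_square)
  ultimately show ?thesis
    using assms(1) by (simp add: add_divide_distrib)
qed

section \<open>Resampling one coordinate and integration by parts\<close>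

locale bernoulli =
  fixes p :: "nat \<Rightarrow> real"
  assumes p: "\<And>k. 0 < p k \<and> p k < 1"
begin

abbreviation P :: "(nat \<Rightarrow> real) measure" where "P \<equiv> bernoulli_space p"
abbreviation D :: "nat \<Rightarrow> ((nat \<Rightarrow> real) \<Rightarrow> real) \<Rightarrow> (nat \<Rightarrow> real) \<Rightarrow> real" where "D \<equiv> grad p"
abbreviation C :: "nat \<Rightarrow> ((nat \<Rightarrow> real) \<Rightarrow> real) \<Rightarrow> (nat \<Rightarrow> real) \<Rightarrow> real" where "C \<equiv> cond_mean p"

lemma p_pos: "0 < p k" and p_less: "p k < 1" and q_pos: "0 < 1 - p k"
  using p[of k] by auto

lemma sd_pos: "0 < sqrt (p k * q_of p k)"
  using p_pos q_pos by simp

lemma sd_square: "sqrt (p k * q_of p k) * sqrt (p k * q_of p k) = p k * q_of p k"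
  using p_pos[of k] q_pos[of k] by simp

sublocale prob_space P
  unfolding bernoulli_space_def by (intro prob_space_PiM prob_space_sign_law p_pos p_less)

lemma space_P: "space P = {w. \<forall>k. w k = 1 \<or> w k = -1}"
  by (auto simp: bernoulli_space_def space_PiM PiE_iff)

lemma measurable_coordinate [measurable]: "(\<lambda>w. w k) \<in> borel_measurable P"
proof -
  have "(\<lambda>w. w k) \<in> P \<rightarrow>\<^sub>M sign_law (p k)"
    unfolding bernoulli_space_def by measurable
  moreover have "(\<lambda>x. x) \<in> sign_law (p k) \<rightarrow>\<^sub>M borel"
    unfolding sign_law_def by simp
  ultimately show ?thesis by (rule measurable_compose)
qed

lemma measurable_Y [measurable]: "Y p k \<in> borel_measurable P"
  unfolding Y_def by measurable

lemma measurable_upd_pair: "(\<lambda>(x, w). w(k := x)) \<in> sign_law (p k) \<Otimes>\<^sub>M P \<rightarrow>\<^sub>M P"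
  unfolding bernoulli_space_def
proof (rule measurable_PiM_single')
  show "(\<lambda>z. (case z of (x, w) \<Rightarrow> w(k := x)) i)
      \<in> sign_law (p k) \<Otimes>\<^sub>M Pi\<^sub>M UNIV (\<lambda>k. sign_law (p k)) \<rightarrow>\<^sub>M sign_law (p i)" for i
    by (cases "i = k") (simp_all add: case_prod_beta)
qed (auto simp: space_pair_measure space_PiM PiE_iff split: prod.splits if_splits)

lemma measurable_upd: "x = 1 \<or> x = -1 \<Longrightarrow> (\<lambda>w. w(k := x)) \<in> P \<rightarrow>\<^sub>M P"
  using measurable_compose[OF measurable_Pair1' measurable_upd_pair, of x k] by auto

text \<open>Coordinate k is independent of the others under the product measure, so a fresh draw of
  it does not change the law. Null sets and integrals are transferred through this identity to the
  maps that fix coordinate k at 1 or -1.\<close>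

lemma resample: "distr (sign_law (p k) \<Otimes>\<^sub>M P) P (\<lambda>(x, w). w(k := x)) = P"
  using distr_pair_PiM_eq_PiM[of UNIV "\<lambda>k. sign_law (p k)" k] prob_space_sign_law p_pos p_less
  by (simp add: bernoulli_space_def)

lemma pair_prob_space_resample: "pair_prob_space (sign_law (p k)) P"
  by (intro pair_prob_space.intro pair_sigma_finite.intro prob_space_imp_sigma_finite
      prob_space_sign_law p_pos p_less prob_space_axioms)

text \<open>After resampling, the exceptional set is null for the product of
  \<open>sign_law (p k)\<close> and P. By Fubini its sections are null for almost every value of the
  coordinate, and both values are atoms.\<close>

lemma
  assumes "AE w in P. Q w"
  shows AE_upd_plus: "AE w in P. Q (w(k := 1))"
    and AE_upd_minus: "AE w in P. Q (w(k := -1))"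
proof -
  interpret pair: pair_prob_space "sign_law (p k)" P by (rule pair_prob_space_resample)
  have "AE z in sign_law (p k) \<Otimes>\<^sub>M P. Q ((\<lambda>(x, w). w(k := x)) z)"
    using assms by (intro AE_distrD[OF measurable_upd_pair]) (simp only: resample)
  from pair.AE_pair[OF this] show "AE w in P. Q (w(k := 1))" "AE w in P. Q (w(k := -1))"
    by (auto simp: AE_sign_law p_pos p_less)
qed

lemma
  fixes G :: "(nat \<Rightarrow> real) \<Rightarrow> real"
  assumes "integrable P G"
  shows integrable_upd_plus: "integrable P (\<lambda>w. G (w(k := 1)))"
    and integrable_upd_minus: "integrable P (\<lambda>w. G (w(k := -1)))"
    and integral_resample: "(\<integral>w. G w \<partial>P)
      = p k * (\<integral>w. G (w(k := 1)) \<partial>P) + q_of p k * (\<integral>w. G (w(k := -1)) \<partial>P)"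
proof -
  interpret pair: pair_prob_space "sign_law (p k)" P by (rule pair_prob_space_resample)
  have G: "G \<in> borel_measurable P" using assms by simp
  have int: "integrable (sign_law (p k) \<Otimes>\<^sub>M P) (\<lambda>z. G ((\<lambda>(x, w). w(k := x)) z))"
    using assms by (subst integrable_distr_eq[OF measurable_upd_pair G, symmetric]) (simp only: resample)
  from pair.AE_integrable_fst'[OF int]
  show "integrable P (\<lambda>w. G (w(k := 1)))" "integrable P (\<lambda>w. G (w(k := -1)))"
    by (auto simp: AE_sign_law p_pos p_less)
  have "(\<integral>w. G w \<partial>P) = (\<integral>z. G ((\<lambda>(x, w). w(k := x)) z) \<partial>(sign_law (p k) \<Otimes>\<^sub>M P))"
    by (subst resample[of k, symmetric], subst integral_distr[OF measurable_upd_pair G]) simp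
  also have "\<dots> = (\<integral>x. (\<integral>w. G (w(k := x)) \<partial>P) \<partial>sign_law (p k))"
    using pair.integral_fst'[OF int] by simp
  also have "\<dots> = p k * (\<integral>w. G (w(k := 1)) \<partial>P) + q_of p k * (\<integral>w. G (w(k := -1)) \<partial>P)"
    by (rule integral_sign_law) (auto simp: p_pos p_less)
  finally show "(\<integral>w. G w \<partial>P)
      = p k * (\<integral>w. G (w(k := 1)) \<partial>P) + q_of p k * (\<integral>w. G (w(k := -1)) \<partial>P)" .
qed

lemma L2_upd: "F \<in> L2 P \<Longrightarrow> x = 1 \<or> x = -1 \<Longrightarrow> (\<lambda>w. F (w(k := x))) \<in> L2 P"
  using integrable_upd_plus[of "\<lambda>w. (F w)\<^sup>2" k] integrable_upd_minus[of "\<lambda>w. (F w)\<^sup>2" k]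
    measurable_compose[OF measurable_upd, of x F borel k]
  by (auto simp: L2_def)

lemma measurable_D:
  assumes "F \<in> borel_measurable P"
  shows "D k F \<in> borel_measurable P"
proof -
  have [measurable]: "(\<lambda>w. F (w(k := 1))) \<in> borel_measurable P"
    "(\<lambda>w. F (w(k := -1))) \<in> borel_measurable P"
    using measurable_compose[OF measurable_upd assms] by auto
  show ?thesis unfolding grad_def by measurable
qed

lemma L2_D: "F \<in> L2 P \<Longrightarrow> D k F \<in> L2 P"
  unfolding grad_def by (intro L2_cmult L2_diff L2_upd) auto

lemma L2_C: "F \<in> L2 P \<Longrightarrow> C k F \<in> L2 P"
  unfolding cond_mean_def by (intro L2_cmult L2_add L2_upd) auto

lemma D_cong_AE:
  assumes "AE w in P. F w = G w"
  shows "AE w in P. D k F w = D k G w"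
  using AE_upd_plus[OF assms, of k] AE_upd_minus[OF assms, of k]
  by eventually_elim (simp add: grad_def)

lemma Y_plus: "Y p k (w(k := 1)) = q_of p k / sqrt (p k * q_of p k)"
  and Y_minus: "Y p k (w(k := -1)) = - p k / sqrt (p k * q_of p k)"
  by (simp_all only: Y_def fun_upd_same two_point_identities)

lemma Y_plus_sd: "Y p k (w(k := 1)) * sqrt (p k * q_of p k) = q_of p k"
  and Y_minus_sd: "Y p k (w(k := -1)) * sqrt (p k * q_of p k) = - p k"
  unfolding Y_plus Y_minus using sd_pos[of k] by (auto simp only: nonzero_eq_divide_eq[symmetric])

lemma p_Y_plus: "p k * Y p k (w(k := 1)) = sqrt (p k * q_of p k)"
  and q_Y_minus: "q_of p k * Y p k (w(k := -1)) = - sqrt (p k * q_of p k)"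
  unfolding Y_plus Y_minus using sd_pos[of k] sd_square[of k]
  by (simp_all only: times_divide_eq_right mult_minus_right divide_eq_eq) simp_all

lemma grad_Y: "D k (Y p k) w = 1"
proof -
  have "D k (Y p k) w = Y p k (w(k := 1)) * sqrt (p k * q_of p k)
      - Y p k (w(k := -1)) * sqrt (p k * q_of p k)"
    by (simp add: grad_def algebra_simps)
  then show ?thesis by (simp only: Y_plus_sd Y_minus_sd)
qed

lemma grad_Y_mult: "free_of k Z \<Longrightarrow> D k (\<lambda>w. Z w * Y p k w) = Z"
  using grad_mult_free[of k Z p "Y p k"] by (simp add: grad_Y mult.commute)

lemma Y_bounded: "\<exists>c. \<forall>w\<in>space P. \<bar>Y p k w\<bar> \<le> c"
proof -
  have "\<bar>Y p k w\<bar> \<le> \<bar>Y p k (w(k := 1))\<bar> + \<bar>Y p k (w(k := -1))\<bar>" if "w \<in> space P" for w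
  proof -
    have "w = w(k := 1) \<or> w = w(k := -1)"
      using that by (auto simp: space_P fun_eq_iff)
    then show ?thesis by (metis abs_ge_zero le_add_same_cancel1 le_add_same_cancel2)
  qed
  then show ?thesis unfolding Y_plus Y_minus by blast
qed

lemma L2_Y_mult: "F \<in> L2 P \<Longrightarrow> (\<lambda>w. F w * Y p k w) \<in> L2 P"
  using Y_bounded[of k] L2_bounded_mult[of F P "Y p k"] by auto

lemma Y_square:
  assumes "w \<in> space P"
  shows "(Y p k w)\<^sup>2 = 1 + phi p k * Y p k w"
proof -
  have "w = w(k := 1) \<or> w = w(k := -1)"
    using assms by (auto simp: space_P fun_eq_iff)
  then have "Y p k w = q_of p k / sqrt (p k * q_of p k) \<or> Y p k w = - p k / sqrt (p k * q_of p k)"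
    by (metis Y_plus Y_minus)
  then show ?thesis
    unfolding phi_def by (rule two_point_square[OF sd_pos sd_square])
qed

text \<open>With the other coordinates fixed, F takes two values and is therefore affine in Y_k. The
  slope is D_k F because \<open>grad_Y\<close> gives Y_k slope 1, and the constant term is the mean
  because Y_k is centred. Membership in \<open>space P\<close> ensures that the coordinate is 1 or
  -1.\<close>

lemma clark_decomposition:
  assumes "w \<in> space P"
  shows "F w = C k F w + Y p k w * D k F w"
proof -
  have "w = w(k := 1) \<or> w = w(k := -1)"
    using assms by (auto simp: space_P fun_eq_iff)
  moreover have "F (w(k := 1)) = C k F w + Y p k (w(k := 1)) * D k F w"
    unfolding grad_def mult.assoc[symmetric] Y_plus_sd by (simp add: cond_mean_def algebra_simps)
  moreover have "F (w(k := -1)) = C k F w + Y p k (w(k := -1)) * D k F w"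
    unfolding grad_def mult.assoc[symmetric] Y_minus_sd by (simp add: cond_mean_def algebra_simps)
  ultimately show ?thesis by metis
qed

text \<open>Resampling weights the value of Y_k at 1 by p and that at -1 by q, and these weighted
  values are s and -s with s = sqrt (p q). The mean of F Y_k thus becomes s times the difference of
  the two values of F, while Z factors out.\<close>

lemma integration_by_parts:
  assumes F: "F \<in> L2 P" and Z: "Z \<in> L2 P" "free_of k Z"
  shows "(\<integral>w. F w * Y p k w * Z w \<partial>P) = (\<integral>w. D k F w * Z w \<partial>P)"
proof -
  let ?s = "sqrt (p k * q_of p k)"
  let ?G = "\<lambda>w. F w * Y p k w * Z w"
  have int: "integrable P ?G"
    using L2_integrable_mult[OF L2_Y_mult[OF F] Z(1)] .
  have i: "integrable P (\<lambda>w. F (w(k := x)) * Z w)" if "x = 1 \<or> x = -1" for x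
    using L2_integrable_mult[OF L2_upd[OF F that] Z(1)] .
  have "p k * ?G (w(k := 1)) = (p k * Y p k (w(k := 1))) * (F (w(k := 1)) * Z w)" for w
    by (simp only: free_ofD[OF Z(2)] mult_ac)
  then have "p k * ?G (w(k := 1)) = ?s * (F (w(k := 1)) * Z w)" for w
    by (simp only: p_Y_plus)
  then have "p k * (\<integral>w. ?G (w(k := 1)) \<partial>P) = (\<integral>w. ?s * (F (w(k := 1)) * Z w) \<partial>P)"
    by (simp only: flip: integral_mult_right_zero)
  moreover have "q_of p k * ?G (w(k := -1)) = (q_of p k * Y p k (w(k := -1))) * (F (w(k := -1)) * Z w)" for w
    by (simp only: free_ofD[OF Z(2)] mult_ac)
  then have "q_of p k * ?G (w(k := -1)) = - ?s * (F (w(k := -1)) * Z w)" for w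
    by (simp only: q_Y_minus)
  then have "q_of p k * (\<integral>w. ?G (w(k := -1)) \<partial>P) = (\<integral>w. - ?s * (F (w(k := -1)) * Z w) \<partial>P)"
    by (simp only: flip: integral_mult_right_zero)
  ultimately have "(\<integral>w. ?G w \<partial>P)
      = (\<integral>w. ?s * (F (w(k := 1)) * Z w) \<partial>P) + (\<integral>w. - ?s * (F (w(k := -1)) * Z w) \<partial>P)"
    using integral_resample[OF int, of k] by simp
  also have "\<dots> = (\<integral>w. ?s * (F (w(k := 1)) * Z w) + - ?s * (F (w(k := -1)) * Z w) \<partial>P)"
    using i by (intro Bochner_Integration.integral_add[symmetric] integrable_mult_right) auto
  also have "\<dots> = (\<integral>w. D k F w * Z w \<partial>P)"
    by (simp add: grad_def algebra_simps)
  finally show ?thesis .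
qed

end

section \<open>Finite products of the Y_k: orthonormality and completeness\<close>

definition walsh :: "(nat \<Rightarrow> real) \<Rightarrow> nat set \<Rightarrow> (nat \<Rightarrow> real) \<Rightarrow> real" where
  "walsh p B w = (\<Prod>k\<in>B. Y p k w)"

lemma free_of_walsh: "k \<notin> B \<Longrightarrow> free_of k (walsh p B)"
  unfolding free_of_def walsh_def
  by (auto intro!: prod.cong simp: Y_def)

lemma walsh_insert: "finite B \<Longrightarrow> k \<notin> B \<Longrightarrow> walsh p (insert k B) = (\<lambda>w. walsh p B w * Y p k w)"
  by (auto simp: walsh_def mult.commute)

lemma walsh_remove: "finite B \<Longrightarrow> k \<in> B \<Longrightarrow> walsh p B = (\<lambda>w. walsh p (B - {k}) w * Y p k w)"
  using walsh_insert[of "B - {k}" k p] by (simp add: insert_absorb)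

lemma walsh_empty [simp]: "walsh p {} w = 1"
  by (simp add: walsh_def)

context bernoulli
begin

lemma L2_walsh: "finite B \<Longrightarrow> walsh p B \<in> L2 P"
proof (induction B rule: finite_induct)
  case empty
  then show ?case by (simp add: walsh_def)
next
  case (insert k B)
  then show ?case by (simp add: walsh_insert L2_Y_mult)
qed

lemma L2_mult_walsh: "finite B \<Longrightarrow> F \<in> L2 P \<Longrightarrow> (\<lambda>w. F w * walsh p B w) \<in> L2 P"
proof (induction B rule: finite_induct)
  case (insert k B)
  then show ?case
    using L2_Y_mult[of "\<lambda>w. F w * walsh p B w" k] by (simp add: walsh_insert mult.assoc)
qed simp

lemma integral_free_Y_free:
  assumes "F \<in> L2 P" "free_of k F" "Z \<in> L2 P" "free_of k Z"
  shows "(\<integral>w. F w * Y p k w * Z w \<partial>P) = 0"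
  using integration_by_parts[OF assms(1,3,4)] assms(2) by (simp add: grad_free)

lemma integral_free_YY_free:
  assumes "F \<in> L2 P" "free_of k F" "Z \<in> L2 P" "free_of k Z"
  shows "(\<integral>w. (F w * Y p k w) * Y p k w * Z w \<partial>P) = (\<integral>w. F w * Z w \<partial>P)"
  using integration_by_parts[OF L2_Y_mult[OF assms(1)] assms(3,4)] assms(2)
  by (simp add: grad_Y_mult)

text \<open>A factor Y_k present in only one product makes the integral vanish, being centred and
  independent of the rest. A factor present in both can be removed because E[Y_k^2] = 1.\<close>

lemma integral_walsh_walsh:
  assumes "finite A" "finite B"
  shows "(\<integral>w. walsh p A w * walsh p B w \<partial>P) = (if A = B then 1 else 0)"
proof -
  have ne: "(\<integral>w. walsh p A w * walsh p B w \<partial>P) = 0"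
    if "finite A" "finite B" "k \<in> A" "k \<notin> B" for A B k
    using that integral_free_Y_free[of "walsh p (A - {k})" k "walsh p B"]
    by (subst walsh_remove[of A k]) (simp_all add: L2_walsh free_of_walsh)
  have eq: "(\<integral>w. walsh p A w * walsh p A w \<partial>P) = 1" if "finite A" for A
    using that
  proof (induction A rule: finite_induct)
    case empty
    then show ?case by (simp add: prob_space)
  next
    case (insert k A)
    then have "(\<integral>w. walsh p (insert k A) w * walsh p (insert k A) w \<partial>P)
        = (\<integral>w. (walsh p A w * Y p k w) * Y p k w * walsh p A w \<partial>P)"
      by (simp add: walsh_insert mult_ac)
    also have "\<dots> = 1"
      using insert by (subst integral_free_YY_free) (simp_all add: L2_walsh free_of_walsh)
    finally show ?case .
  qed
  show ?thesis
    using assms eq[of A] ne[of A B] ne[of B A] by (auto simp: mult.commute)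
qed

text \<open>Each factor depends on one coordinate and is affine in Y_j by
  \<open>clark_decomposition\<close>; multiplying out the product gives one term for each subset of
  J.\<close>

lemma indicator_as_walsh_sum:
  assumes "finite J" "w \<in> space P"
  shows "(\<Prod>j\<in>J. indicator (A j) (w j))
    = (\<Sum>X\<in>Pow J. (\<Prod>j\<in>X. D j (\<lambda>w. indicator (A j) (w j)) w) *
        (\<Prod>j\<in>J - X. C j (\<lambda>w. indicator (A j) (w j)) w) * walsh p X w)"
proof -
  have "(\<Prod>j\<in>J. indicator (A j) (w j) :: real)
      = (\<Prod>j\<in>J. Y p j w * D j (\<lambda>w. indicator (A j) (w j)) w + C j (\<lambda>w. indicator (A j) (w j)) w)"
    using clark_decomposition[OF assms(2), of "\<lambda>w. indicator (A _) (w _)"]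
    by (intro prod.cong refl) (simp add: add.commute)
  also have "\<dots> = (\<Sum>X\<in>Pow J. (\<Prod>j\<in>X. Y p j w * D j (\<lambda>w. indicator (A j) (w j)) w) *
      (\<Prod>j\<in>J - X. C j (\<lambda>w. indicator (A j) (w j)) w))"
    by (rule prod_add) fact
  finally show ?thesis
    by (simp add: prod.distrib walsh_def mult_ac)
qed

text \<open>The positive and the negative part of \<open>F\<close> are densities of measures that agree on cylinder
  sets, because the indicator function of a cylinder set is a finite combination of Walsh functions.\<close>

lemma walsh_complete:
  assumes F: "F \<in> L2 P" and zero: "\<And>B. finite B \<Longrightarrow> (\<integral>w. F w * walsh p B w \<partial>P) = 0"
  shows "AE w in P. F w = 0"
proof -
  have [measurable]: "F \<in> borel_measurable P" and int: "integrable P F"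
    using F by (auto intro: L2_measurable L2_integrable)
  define Mp Mn where "Mp = density P (\<lambda>w. ennreal (F w))" and "Mn = density P (\<lambda>w. ennreal (- F w))"
  have fin: "(\<integral>\<^sup>+w. ennreal (F w) \<partial>P) < \<infinity>"
    using int by (simp add: real_integrable_def less_top)
  have "Mp = Mn"
  proof (rule measure_eqI_PiM_infinite)
    show "sets Mp = sets (\<Pi>\<^sub>M k\<in>UNIV. sign_law (p k))" "sets Mn = sets (\<Pi>\<^sub>M k\<in>UNIV. sign_law (p k))"
      by (simp_all add: Mp_def Mn_def bernoulli_space_def)
    show "finite_measure Mp"
      using fin by (intro finite_measureI) (simp add: Mp_def emeasure_density cong: nn_integral_cong)
  next
    fix A J assume J: "finite J" and A: "\<And>j. j \<in> J \<Longrightarrow> A j \<in> sets (sign_law (p j))"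
    let ?X = "prod_emb UNIV (\<lambda>k. sign_law (p k)) J (Pi\<^sub>E J A)"
    have X [measurable]: "?X \<in> sets P"
      unfolding bernoulli_space_def using J A by (intro sets_PiM_I) auto
    have "indicator ?X w = (\<Prod>j\<in>J. indicator (A j) (w j) :: real)" if "w \<in> space P" for w
    proof -
      have "w \<in> ?X \<longleftrightarrow> (\<forall>j\<in>J. w j \<in> A j)"
        using that by (auto simp: prod_emb_def bernoulli_space_def space_PiM PiE_iff restrict_def extensional_def)
      then show ?thesis
        using J by (auto simp: indicator_def prod_zero_iff)
    qed
    then have "(\<integral>w. F w * indicator ?X w \<partial>P)
        = (\<integral>w. (\<Sum>Z\<in>Pow J. (\<Prod>j\<in>Z. D j (\<lambda>w. indicator (A j) (w j)) w) *
        (\<Prod>j\<in>J - Z. C j (\<lambda>w. indicator (A j) (w j)) w) * (F w * walsh p Z w)) \<partial>P)"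
      by (intro Bochner_Integration.integral_cong refl)
        (simp add: indicator_as_walsh_sum[OF J] sum_distrib_left mult_ac)
    \<comment> \<open>For a function of coordinate j alone, D j and C j do not depend on w. Each
      term is therefore a constant times one of the coefficients of F that vanish by
      assumption.\<close>
    also have "\<dots> = 0"
      using J L2_integrable[OF L2_mult_walsh[OF _ F]] zero finite_subset[OF _ J]
      by (simp add: grad_def cond_mean_def Bochner_Integration.integral_sum)
    finally have "(\<integral>w. F w * indicator ?X w \<partial>P) = 0" .
    moreover have "integrable P (\<lambda>w. F w * indicator ?X w)"
      by (rule integrable_real_mult_indicator[OF X int])
    moreover define a b where "a = (\<integral>\<^sup>+w. ennreal (F w * indicator ?X w) \<partial>P)"
      and "b = (\<integral>\<^sup>+w. ennreal (- (F w * indicator ?X w)) \<partial>P)"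
    ultimately have "enn2real a = enn2real b" "a < \<infinity>" "b < \<infinity>"
      unfolding real_lebesgue_integral_def[OF \<open>integrable P (\<lambda>w. F w * indicator ?X w)\<close>]
        real_integrable_def less_top by (auto simp: less_top)
    then have "a = b"
      by (metis ennreal_enn2real infinity_ennreal_def)
    moreover have "emeasure Mp ?X = a"
      unfolding Mp_def a_def by (subst emeasure_density) (auto intro!: nn_integral_cong simp: indicator_def)
    moreover have "emeasure Mn ?X = b"
      unfolding Mn_def b_def by (subst emeasure_density) (auto intro!: nn_integral_cong simp: indicator_def)
    ultimately show "emeasure Mp ?X = emeasure Mn ?X" by simp
  qed
  \<comment> \<open>\<open>ennreal\<close> sends negative reals to 0, so this equates the positive
    and the negative part of F, which is possible at F = 0 only.\<close>
  then have "AE w in P. ennreal (F w) = ennreal (- F w)"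
    using fin finite_density_unique[of "\<lambda>w. ennreal (F w)" P "\<lambda>w. ennreal (- F w)"]
    unfolding Mp_def Mn_def by simp
  then show ?thesis
  proof eventually_elim
    case (elim w)
    then show ?case
      by (cases "F w" "0 :: real" rule: linorder_cases) (auto simp: ennreal_neg)
  qed
qed

section \<open>Moments and coefficients of the combined terms\<close>

definition summand :: "nat \<Rightarrow> ((nat \<Rightarrow> real) \<Rightarrow> real) \<Rightarrow> (nat \<Rightarrow> real) \<Rightarrow> real" where
  "summand k F w = C k F w * Y p k w"

lemma summand_eq:
  assumes "w \<in> space P"
  shows "summand k F w = F w * Y p k w - D k F w - phi p k * D k F w * Y p k w"
proof -
  have "F w * Y p k w = C k F w * Y p k w + D k F w * (Y p k w)\<^sup>2"
    by (subst clark_decomposition[OF assms, of F k]) (simp add: power2_eq_square algebra_simps)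
  then show ?thesis
    unfolding Y_square[OF assms] by (simp add: summand_def algebra_simps)
qed

lemma L2_summand: "F \<in> L2 P \<Longrightarrow> summand k F \<in> L2 P"
  unfolding summand_def by (intro L2_Y_mult L2_C)

text \<open>C_k F and Y_k D_k F are orthogonal, and multiplication by Y_k preserves the norm of a
  function free of coordinate k. So E[F^2] splits into E[(C_k F)^2] and E[(D_k F)^2], and the first
  of these is the squared norm of \<open>summand k F\<close>.\<close>

lemma integral_summand_square:
  assumes F: "F \<in> L2 P"
  shows "(\<integral>w. (summand k F w)\<^sup>2 \<partial>P) = (\<integral>w. (F w)\<^sup>2 \<partial>P) - (\<integral>w. (D k F w)\<^sup>2 \<partial>P)"
proof -
  note L2s = L2_C[OF F, of k] L2_D[OF F, of k]
  note free = free_of_cond_mean_self[of k p F] free_of_grad_self[of k p F]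
  have cross: "(\<integral>w. C k F w * Y p k w * D k F w \<partial>P) = 0"
    by (intro integral_free_Y_free L2s free)
  have sqC: "(\<integral>w. (C k F w * Y p k w)\<^sup>2 \<partial>P) = (\<integral>w. (C k F w)\<^sup>2 \<partial>P)"
    using integral_free_YY_free[OF L2s(1) free(1) L2s(1) free(1)]
    by (simp add: power2_eq_square mult_ac)
  have sqD: "(\<integral>w. (D k F w * Y p k w)\<^sup>2 \<partial>P) = (\<integral>w. (D k F w)\<^sup>2 \<partial>P)"
    using integral_free_YY_free[OF L2s(2) free(2) L2s(2) free(2)]
    by (simp add: power2_eq_square mult_ac)
  have "(\<integral>w. (F w)\<^sup>2 \<partial>P) = (\<integral>w. (C k F w)\<^sup>2 + 2 * (C k F w * Y p k w * D k F w)
      + (D k F w * Y p k w)\<^sup>2 \<partial>P)"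
    by (intro Bochner_Integration.integral_cong refl, subst clark_decomposition[of _ F k])
      (auto simp: power2_eq_square algebra_simps)
  also have "\<dots> = (\<integral>w. (C k F w)\<^sup>2 \<partial>P) + (\<integral>w. (D k F w)\<^sup>2 \<partial>P)"
    using L2_integrable_square[OF L2s(1)] L2_integrable_square[OF L2_Y_mult[OF L2s(2)]]
      L2_integrable_mult[OF L2_Y_mult[OF L2s(1)] L2s(2)] cross sqD
    by simp
  finally show ?thesis by (simp add: summand_def sqC)
qed

text \<open>A by-product of the preceding identity, whose left-hand side is nonnegative. It makes
  each D_k a contraction of L2, so that gradients pass to mean square limits.\<close>

lemma integral_D_square_le:
  assumes "F \<in> L2 P"
  shows "(\<integral>w. (D k F w)\<^sup>2 \<partial>P) \<le> (\<integral>w. (F w)\<^sup>2 \<partial>P)"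
proof -
  have "0 \<le> (\<integral>w. (summand k F w)\<^sup>2 \<partial>P)" by simp
  then show ?thesis
    using integral_summand_square[OF assms, of k] by linarith
qed

text \<open>C_k F acts as the conditional expectation given the other coordinates: the remaining
  part Y_k D_k F is orthogonal to every square-integrable Z free of coordinate k.\<close>

lemma integral_C_free:
  assumes F: "F \<in> L2 P" and Z: "Z \<in> L2 P" "free_of k Z"
  shows "(\<integral>w. C k F w * Z w \<partial>P) = (\<integral>w. F w * Z w \<partial>P)"
proof -
  have "(\<integral>w. F w * Z w \<partial>P) = (\<integral>w. C k F w * Z w + D k F w * Y p k w * Z w \<partial>P)"
    by (intro Bochner_Integration.integral_cong refl, subst clark_decomposition[of _ F k])
      (auto simp: algebra_simps)
  also have "\<dots> = (\<integral>w. C k F w * Z w \<partial>P) + (\<integral>w. D k F w * Y p k w * Z w \<partial>P)"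
    by (intro Bochner_Integration.integral_add L2_integrable_mult L2_Y_mult L2_C L2_D F Z)
  also have "(\<integral>w. D k F w * Y p k w * Z w \<partial>P) = 0"
    by (intro integral_free_Y_free L2_D F Z free_of_grad_self)
  finally show ?thesis by simp
qed

lemma integral_summand_mult:
  assumes F: "F \<in> L2 P" and G: "G \<in> L2 P" and "k \<noteq> l"
  shows "(\<integral>w. summand k F w * summand l G w \<partial>P) = (\<integral>w. D k G w * D l F w \<partial>P)"
proof -
  have "(\<integral>w. summand k F w * summand l G w \<partial>P)
      = (\<integral>w. (C l G w * Y p l w) * Y p k w * C k F w \<partial>P)"
    by (simp add: summand_def mult_ac)
  also have "\<dots> = (\<integral>w. D k (\<lambda>w. C l G w * Y p l w) w * C k F w \<partial>P)"
    by (intro integration_by_parts L2_Y_mult L2_C F G free_of_cond_mean_self)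
  also have "\<dots> = (\<integral>w. C k F w * Y p l w * D k (C l G) w \<partial>P)"
    using \<open>k \<noteq> l\<close> by (subst grad_mult_free) (simp_all add: free_of_Y mult_ac)
  also have "\<dots> = (\<integral>w. D l (C k F) w * D k (C l G) w \<partial>P)"
    by (intro integration_by_parts L2_D L2_C F G free_of_grad free_of_cond_mean_self)
  also have "\<dots> = (\<integral>w. C k (D l F) w * C l (D k G) w \<partial>P)"
    using \<open>k \<noteq> l\<close> by (simp add: grad_cond_mean)
  also have "\<dots> = (\<integral>w. D l F w * C l (D k G) w \<partial>P)"
    by (intro integral_C_free L2_D L2_C F G free_of_cond_mean free_of_grad_self)
  also have "\<dots> = (\<integral>w. C l (D k G) w * D l F w \<partial>P)"
    by (simp add: mult.commute)
  also have "\<dots> = (\<integral>w. D k G w * D l F w \<partial>P)"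
    by (intro integral_C_free L2_D F G free_of_grad_self)
  finally show ?thesis .
qed

text \<open>In terms of coefficients, passing from F to \<open>summand k F\<close> discards the
  products that contain Y_k and multiplies the others by Y_k.\<close>

lemma integral_summand_walsh:
  assumes F: "F \<in> L2 P" and B: "finite B"
  shows "(\<integral>w. summand k F w * walsh p B w \<partial>P)
    = (if k \<in> B then \<integral>w. F w * walsh p (B - {k}) w \<partial>P else 0)"
proof (cases "k \<in> B")
  case True
  have "(\<integral>w. summand k F w * walsh p B w \<partial>P)
      = (\<integral>w. (C k F w * Y p k w) * Y p k w * walsh p (B - {k}) w \<partial>P)"
    by (simp add: summand_def walsh_remove[OF B True] mult_ac)
  also have "\<dots> = (\<integral>w. C k F w * walsh p (B - {k}) w \<partial>P)"
    using B by (intro integral_free_YY_free L2_C F L2_walsh free_of_walsh free_of_cond_mean_self) auto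
  also have "\<dots> = (\<integral>w. F w * walsh p (B - {k}) w \<partial>P)"
    using B by (intro integral_C_free F L2_walsh free_of_walsh) auto
  finally show ?thesis using True by simp
next
  case False
  then show ?thesis
    using integral_free_Y_free[OF L2_C[OF F] free_of_cond_mean_self L2_walsh[OF B] free_of_walsh]
    by (simp add: summand_def)
qed

end

section \<open>Multiple stochastic integrals\<close>

definition chaos_sum :: "(nat \<Rightarrow> real) \<Rightarrow> (nat list \<Rightarrow> real) \<Rightarrow> nat list set \<Rightarrow> (nat \<Rightarrow> real) \<Rightarrow> real" where
  "chaos_sum p f A w = (\<Sum>ks\<in>A. f ks * (\<Prod>k\<leftarrow>ks. Y p k w))"

lemma prod_list_Y: "distinct ks \<Longrightarrow> (\<Prod>k\<leftarrow>ks. Y p k w) = walsh p (set ks) w"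
  by (simp add: walsh_def prod.distinct_set_conv_list)

lemma permutations_of_set_Delta: "finite B \<Longrightarrow> permutations_of_set B \<subseteq> Delta (card B)"
  by (auto simp: permutations_of_set_def Delta_def distinct_card)

lemma permutations_of_set_Int_Delta:
  "finite B \<Longrightarrow> permutations_of_set B \<inter> Delta n = (if card B = n then permutations_of_set B else {})"
  using permutations_of_set_Delta[of B] by (auto simp: Delta_def)

text \<open>All orderings of the same indices give the same product of the Y_k. Their coefficients
  must be added up before the orthogonality of the products can be used.\<close>

definition collected_coeff :: "(nat list \<Rightarrow> real) \<Rightarrow> nat list set \<Rightarrow> nat set \<Rightarrow> real" where
  "collected_coeff f A B = (\<Sum>ks | ks \<in> A \<and> set ks = B. f ks)"

lemma chaos_sum_walsh:
  assumes "finite A" "A \<subseteq> Delta n"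
  shows "chaos_sum p f A w = (\<Sum>B\<in>set ` A. collected_coeff f A B * walsh p B w)"
proof -
  have "chaos_sum p f A w = (\<Sum>ks\<in>A. f ks * walsh p (set ks) w)"
    unfolding chaos_sum_def using assms(2)
    by (intro sum.cong refl) (auto simp: Delta_def prod_list_Y)
  also have "\<dots> = (\<Sum>B\<in>set ` A. \<Sum>ks | ks \<in> A \<and> set ks = B. f ks * walsh p (set ks) w)"
    using assms(1) by (rule sum.image_gen)
  also have "\<dots> = (\<Sum>B\<in>set ` A. collected_coeff f A B * walsh p B w)"
    unfolding collected_coeff_def sum_distrib_right by (intro sum.cong refl) auto
  finally show ?thesis .
qed

text \<open>An index set has at most n! orderings in A, and this is the price of the Cauchy-Schwarz
  inequality for the sum over them.\<close>

lemma sum_collected_coeff_square_le: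
  assumes "finite A" "A \<subseteq> Delta n"
  shows "(\<Sum>B\<in>set ` A. (collected_coeff f A B)\<^sup>2) \<le> fact n * (\<Sum>ks\<in>A. (f ks)\<^sup>2)"
proof -
  have "(collected_coeff f A B)\<^sup>2 \<le> fact n * (\<Sum>ks | ks \<in> A \<and> set ks = B. (f ks)\<^sup>2)"
    if "B \<in> set ` A" for B
  proof -
    let ?I = "{ks. ks \<in> A \<and> set ks = B}"
    have B: "finite B" "card B = n"
      using that assms(2) by (auto simp: Delta_def distinct_card)
    have "?I \<subseteq> permutations_of_set B"
      using assms(2) by (auto simp: Delta_def permutations_of_set_def)
    then have "card ?I \<le> fact n"
      using card_mono[OF finite_permutations_of_set, of ?I B] B by simp
    then have card: "real (card ?I) \<le> fact n"
      by (metis of_nat_fact of_nat_le_iff)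
    have "(collected_coeff f A B)\<^sup>2 \<le> (\<Sum>ks\<in>?I. (f ks)\<^sup>2) * card ?I"
      unfolding collected_coeff_def by (rule sum_squared_le_sum_of_squares)
    also have "\<dots> \<le> (\<Sum>ks\<in>?I. (f ks)\<^sup>2) * fact n"
      using card by (intro mult_left_mono sum_nonneg) auto
    finally show ?thesis by (simp add: mult.commute)
  qed
  then have "(\<Sum>B\<in>set ` A. (collected_coeff f A B)\<^sup>2)
      \<le> (\<Sum>B\<in>set ` A. fact n * (\<Sum>ks | ks \<in> A \<and> set ks = B. (f ks)\<^sup>2))"
    by (rule sum_mono)
  also have "\<dots> = fact n * (\<Sum>ks\<in>A. (f ks)\<^sup>2)"
    using sum.image_gen[OF assms(1), of "\<lambda>ks. (f ks)\<^sup>2" set] by (simp add: sum_distrib_left)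
  finally show ?thesis .
qed

section \<open>Norm estimates for finite chaos sums and their limits\<close>

context bernoulli
begin

text \<open>Pythagoras for an orthonormal system. The index map \<open>\<beta>\<close> allows the
  products to run over the sets \<open>B - {k}\<close> while the coefficients stay indexed by
  B.\<close>

lemma integral_walsh_sum_square:
  assumes "finite I" "\<And>i. i \<in> I \<Longrightarrow> finite (\<beta> i)" "inj_on \<beta> I"
  shows "(\<integral>w. (\<Sum>i\<in>I. c i * walsh p (\<beta> i) w)\<^sup>2 \<partial>P) = (\<Sum>i\<in>I. (c i)\<^sup>2)"
proof -
  have "(\<integral>w. (\<Sum>i\<in>I. c i * walsh p (\<beta> i) w)\<^sup>2 \<partial>P)
      = (\<integral>w. (\<Sum>i\<in>I. \<Sum>j\<in>I. c i * c j * (walsh p (\<beta> i) w * walsh p (\<beta> j) w)) \<partial>P)"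
    by (simp add: power2_eq_square sum_product mult_ac)
  also have "\<dots> = (\<Sum>i\<in>I. \<Sum>j\<in>I. c i * c j * (\<integral>w. walsh p (\<beta> i) w * walsh p (\<beta> j) w \<partial>P))"
    using assms(2) L2_integrable_mult[OF L2_walsh L2_walsh]
    by (simp add: Bochner_Integration.integral_sum)
  also have "\<dots> = (\<Sum>i\<in>I. \<Sum>j\<in>I. if i = j then (c i)\<^sup>2 else 0)"
    using assms(2,3) by (intro sum.cong refl)
      (auto simp: integral_walsh_walsh power2_eq_square dest: inj_onD)
  also have "\<dots> = (\<Sum>i\<in>I. (c i)\<^sup>2)"
    using assms(1) by simp
  finally show ?thesis .
qed

lemma D_walsh: "finite B \<Longrightarrow> D k (walsh p B) w = (if k \<in> B then walsh p (B - {k}) w else 0)"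
  using grad_Y_mult[OF free_of_walsh[of k "B - {k}" p]] walsh_remove[of B k p]
  by (auto simp: grad_free free_of_walsh)

lemma L2_chaos_sum: "A \<subseteq> Delta n \<Longrightarrow> chaos_sum p f A \<in> L2 P"
  unfolding chaos_sum_def
  by (intro L2_sum L2_cmult)
    (auto simp: Delta_def prod_list_Y intro!: L2_walsh)

lemma integral_chaos_sum_square_le:
  assumes "finite A" "A \<subseteq> Delta n"
  shows "(\<integral>w. (chaos_sum p f A w)\<^sup>2 \<partial>P) \<le> fact n * (\<Sum>ks\<in>A. (f ks)\<^sup>2)"
proof -
  have "(\<integral>w. (chaos_sum p f A w)\<^sup>2 \<partial>P) = (\<Sum>B\<in>set ` A. (collected_coeff f A B)\<^sup>2)"
    unfolding chaos_sum_walsh[OF assms] using assms(1)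
    by (intro integral_walsh_sum_square[where \<beta> = "\<lambda>B. B"]) auto
  then show ?thesis using sum_collected_coeff_square_le[OF assms] by simp
qed

text \<open>D_k annihilates a product without the factor Y_k and removes that factor otherwise. The
  coefficient at B is thus counted once for each k in \<open>K \<inter> B\<close>, at most n
  times.\<close>

lemma sum_integral_D_chaos_sum_le:
  assumes A: "finite A" "A \<subseteq> Delta n" and "finite K"
  shows "(\<Sum>k\<in>K. \<integral>w. (D k (chaos_sum p f A) w)\<^sup>2 \<partial>P) \<le> real n * (fact n * (\<Sum>ks\<in>A. (f ks)\<^sup>2))"
proof -
  define \<B> where "\<B> = set ` A"
  define c where "c B = (collected_coeff f A B)\<^sup>2" for B
  have \<B>: "finite \<B>" "\<And>B. B \<in> \<B> \<Longrightarrow> finite B" "\<And>B. B \<in> \<B> \<Longrightarrow> card B = n"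
    using A by (auto simp: \<B>_def Delta_def distinct_card)
  have "(\<integral>w. (D k (chaos_sum p f A) w)\<^sup>2 \<partial>P) = (\<Sum>B\<in>\<B>. if k \<in> B then c B else 0)" for k
  proof -
    have "D k (chaos_sum p f A) w
        = (\<Sum>B\<in>{B\<in>\<B>. k \<in> B}. collected_coeff f A B * walsh p (B - {k}) w)" for w
    proof -
      have "D k (chaos_sum p f A) w = D k (\<lambda>w. \<Sum>B\<in>\<B>. collected_coeff f A B * walsh p B w) w"
        by (simp add: grad_def chaos_sum_walsh[OF A] \<B>_def)
      also have "\<dots> = (\<Sum>B\<in>\<B>. collected_coeff f A B * D k (walsh p B) w)"
        by (simp add: grad_sum grad_cmult)
      also have "\<dots> = (\<Sum>B\<in>\<B>. if k \<in> B then collected_coeff f A B * walsh p (B - {k}) w else 0)"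
        using \<B> by (intro sum.cong refl) (simp add: D_walsh)
      also have "\<dots> = (\<Sum>B\<in>{B\<in>\<B>. k \<in> B}. collected_coeff f A B * walsh p (B - {k}) w)"
        using \<B>(1) by (simp add: sum.inter_filter)
      finally show ?thesis .
    qed
    then have "(\<integral>w. (D k (chaos_sum p f A) w)\<^sup>2 \<partial>P)
        = (\<integral>w. (\<Sum>B\<in>{B\<in>\<B>. k \<in> B}. collected_coeff f A B * walsh p (B - {k}) w)\<^sup>2 \<partial>P)"
      by simp
    \<comment> \<open>Removing k is injective on the sets that contain k, so the remaining products
      are still pairwise distinct.\<close>
    also have "\<dots> = (\<Sum>B\<in>{B\<in>\<B>. k \<in> B}. (collected_coeff f A B)\<^sup>2)"
      using \<B> by (intro integral_walsh_sum_square) (auto intro!: inj_onI)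
    also have "\<dots> = (\<Sum>B\<in>\<B>. if k \<in> B then c B else 0)"
      unfolding c_def using \<B>(1) by (simp add: sum.inter_filter)
    finally show ?thesis .
  qed
  then have "(\<Sum>k\<in>K. \<integral>w. (D k (chaos_sum p f A) w)\<^sup>2 \<partial>P)
      = (\<Sum>k\<in>K. \<Sum>B\<in>\<B>. if k \<in> B then c B else 0)"
    by simp
  also have "\<dots> = (\<Sum>B\<in>\<B>. \<Sum>k\<in>K. if k \<in> B then c B else 0)"
    by (rule sum.swap)
  also have "\<dots> = (\<Sum>B\<in>\<B>. real (card (K \<inter> B)) * c B)"
    using \<open>finite K\<close> by (simp flip: sum.inter_restrict)
  also have "\<dots> \<le> (\<Sum>B\<in>\<B>. real n * c B)"
  proof (intro sum_mono mult_right_mono)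
    show "real (card (K \<inter> B)) \<le> real n" if "B \<in> \<B>" for B
      using \<B>(2,3)[OF that] card_mono[of B "K \<inter> B"] by simp
  qed (simp add: c_def)
  also have "\<dots> \<le> real n * (fact n * (\<Sum>ks\<in>A. (f ks)\<^sup>2))"
    using sum_collected_coeff_square_le[OF A, of f]
    by (simp add: sum_distrib_left[symmetric] c_def \<B>_def mult_left_mono)
  finally show ?thesis .
qed

lemma L2_tendsto_D:
  assumes S: "L2_tendsto P S F A"
  shows "L2_tendsto P (\<lambda>i. D k (S i)) (D k F) A"
proof (rule L2_tendstoI_le)
  show "D k F \<in> L2 P" by (intro L2_D L2_tendstoD(1)[OF S])
  show "\<forall>\<^sub>F i in A. D k (S i) \<in> L2 P"
    using L2_tendstoD(2)[OF S] by eventually_elim (rule L2_D)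
  show "((\<lambda>i. \<integral>w. (S i w - F w)\<^sup>2 \<partial>P) \<longlongrightarrow> 0) A" by (rule L2_tendstoD(3)[OF S])
  show "\<forall>\<^sub>F i in A. (\<integral>w. (D k (S i) w - D k F w)\<^sup>2 \<partial>P) \<le> (\<integral>w. (S i w - F w)\<^sup>2 \<partial>P)"
    using L2_tendstoD(2)[OF S]
  proof eventually_elim
    case (elim i)
    show ?case
      using integral_D_square_le[OF L2_diff[OF elim L2_tendstoD(1)[OF S]], of k]
      by (simp add: grad_diff)
  qed
qed

context
  fixes n :: nat and f :: "nat list \<Rightarrow> real"
  assumes f: "(\<lambda>ks. (f ks)\<^sup>2) summable_on Delta n"
begin

text \<open>Shows that the choice in \<open>multint\<close> denotes an actual limit: the squared
  norm of a finite partial sum is at most n! times the sum of the squared kernel values.\<close>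

lemma L2_tendsto_multint:
  "L2_tendsto P (\<lambda>A. chaos_sum p f A) (multint p n f) (finite_subsets_at_top (Delta n))"
proof -
  have "\<exists>F. L2_tendsto P (\<lambda>A w. \<Sum>ks\<in>A. f ks * (\<Prod>k\<leftarrow>ks. Y p k w)) F (finite_subsets_at_top (Delta n))"
  proof (rule L2_unconditional_convergence)
    show "(\<lambda>w. f ks * (\<Prod>k\<leftarrow>ks. Y p k w)) \<in> L2 P" if "ks \<in> Delta n" for ks
      using L2_chaos_sum[of "{ks}" n f] that by (simp add: chaos_sum_def[abs_def])
    show "(\<lambda>ks. fact n * (f ks)\<^sup>2) summable_on Delta n"
      by (intro summable_on_cmult_right f)
    show "(\<integral>w. (\<Sum>ks\<in>A. f ks * (\<Prod>k\<leftarrow>ks. Y p k w))\<^sup>2 \<partial>P) \<le> (\<Sum>ks\<in>A. fact n * (f ks)\<^sup>2)"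
      if "finite A" "A \<subseteq> Delta n" for A
      using integral_chaos_sum_square_le[OF that, of f]
      by (simp add: chaos_sum_def sum_distrib_left)
  qed auto
  then show ?thesis
    unfolding multint_def chaos_sum_def[abs_def] by (rule someI_ex)
qed

lemma L2_multint: "multint p n f \<in> L2 P"
  using L2_tendstoD(1)[OF L2_tendsto_multint] .

lemma sum_square_le_infsum:
  "finite A \<Longrightarrow> A \<subseteq> Delta n \<Longrightarrow> (\<Sum>ks\<in>A. (f ks)\<^sup>2) \<le> (\<Sum>\<^sub>\<infinity>ks\<in>Delta n. (f ks)\<^sup>2)"
  using f by (intro finite_sum_le_infsum) auto

lemma integral_multint_square_le:
  "(\<integral>w. (multint p n f w)\<^sup>2 \<partial>P) \<le> fact n * (\<Sum>\<^sub>\<infinity>ks\<in>Delta n. (f ks)\<^sup>2)"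
proof (rule tendsto_upperbound[OF L2_tendsto_integral_square[OF L2_tendsto_multint]])
  show "\<forall>\<^sub>F A in finite_subsets_at_top (Delta n).
      (\<integral>w. (chaos_sum p f A w)\<^sup>2 \<partial>P) \<le> fact n * (\<Sum>\<^sub>\<infinity>ks\<in>Delta n. (f ks)\<^sup>2)"
  proof (rule eventually_finite_subsets_at_top_weakI)
    fix A assume A: "finite A" "A \<subseteq> Delta n"
    have "fact n * (\<Sum>ks\<in>A. (f ks)\<^sup>2) \<le> fact n * (\<Sum>\<^sub>\<infinity>ks\<in>Delta n. (f ks)\<^sup>2)"
      using sum_square_le_infsum[OF A] by (intro mult_left_mono) auto
    then show "(\<integral>w. (chaos_sum p f A w)\<^sup>2 \<partial>P) \<le> fact n * (\<Sum>\<^sub>\<infinity>ks\<in>Delta n. (f ks)\<^sup>2)"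
      using integral_chaos_sum_square_le[OF A, of f] by linarith
  qed
qed simp

lemma sum_integral_D_multint_le:
  assumes "finite K"
  shows "(\<Sum>k\<in>K. \<integral>w. (D k (multint p n f) w)\<^sup>2 \<partial>P)
    \<le> real n * (fact n * (\<Sum>\<^sub>\<infinity>ks\<in>Delta n. (f ks)\<^sup>2))"
proof (rule tendsto_upperbound)
  show "((\<lambda>A. \<Sum>k\<in>K. \<integral>w. (D k (chaos_sum p f A) w)\<^sup>2 \<partial>P)
      \<longlongrightarrow> (\<Sum>k\<in>K. \<integral>w. (D k (multint p n f) w)\<^sup>2 \<partial>P)) (finite_subsets_at_top (Delta n))"
    by (intro tendsto_sum L2_tendsto_integral_square L2_tendsto_D L2_tendsto_multint)
  show "\<forall>\<^sub>F A in finite_subsets_at_top (Delta n).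
      (\<Sum>k\<in>K. \<integral>w. (D k (chaos_sum p f A) w)\<^sup>2 \<partial>P)
      \<le> real n * (fact n * (\<Sum>\<^sub>\<infinity>ks\<in>Delta n. (f ks)\<^sup>2))"
  proof (rule eventually_finite_subsets_at_top_weakI)
    fix A assume A: "finite A" "A \<subseteq> Delta n"
    have "real n * (fact n * (\<Sum>ks\<in>A. (f ks)\<^sup>2)) \<le> real n * (fact n * (\<Sum>\<^sub>\<infinity>ks\<in>Delta n. (f ks)\<^sup>2))"
      using sum_square_le_infsum[OF A] by (intro mult_left_mono) auto
    then show "(\<Sum>k\<in>K. \<integral>w. (D k (chaos_sum p f A) w)\<^sup>2 \<partial>P)
        \<le> real n * (fact n * (\<Sum>\<^sub>\<infinity>ks\<in>Delta n. (f ks)\<^sup>2))"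
      using sum_integral_D_chaos_sum_le[OF A assms, of f] by linarith
  qed
qed simp

text \<open>Only the finitely many orderings of B contribute. The pairing with a partial sum is
  constant once these are included, and its limit is that constant.\<close>

lemma integral_multint_walsh:
  assumes B: "finite B"
  shows "(\<integral>w. multint p n f w * walsh p B w \<partial>P)
    = (if card B = n then \<Sum>ks\<in>permutations_of_set B. f ks else 0)"
proof -
  let ?B = "permutations_of_set B \<inter> Delta n"
  have "(\<integral>w. chaos_sum p f A w * walsh p B w \<partial>P) = (\<Sum>ks\<in>?B. f ks)"
    if A: "finite A" "A \<subseteq> Delta n" "?B \<subseteq> A" for A
  proof -
    have "(\<integral>w. chaos_sum p f A w * walsh p B w \<partial>P)
        = (\<integral>w. (\<Sum>ks\<in>A. f ks * (walsh p (set ks) w * walsh p B w)) \<partial>P)"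
      using A(2) unfolding chaos_sum_def sum_distrib_right
      by (intro Bochner_Integration.integral_cong sum.cong refl)
        (auto simp: Delta_def prod_list_Y mult_ac)
    also have "\<dots> = (\<Sum>ks\<in>A. f ks * (\<integral>w. walsh p (set ks) w * walsh p B w \<partial>P))"
      using L2_integrable_mult[OF L2_walsh L2_walsh] B
      by (simp add: Bochner_Integration.integral_sum)
    also have "\<dots> = (\<Sum>ks\<in>A. if set ks = B then f ks else 0)"
      using B by (intro sum.cong refl) (simp add: integral_walsh_walsh)
    also have "\<dots> = (\<Sum>ks\<in>?B. f ks)"
      using A by (intro sum.mono_neutral_cong_right)
        (auto simp: permutations_of_set_def Delta_def)
    finally show ?thesis .
  qed
  then have "\<forall>\<^sub>F A in finite_subsets_at_top (Delta n).
      (\<integral>w. chaos_sum p f A w * walsh p B w \<partial>P) = (\<Sum>ks\<in>?B. f ks)"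
    unfolding eventually_finite_subsets_at_top by (intro exI[of _ ?B]) auto
  then have "((\<lambda>A. \<integral>w. chaos_sum p f A w * walsh p B w \<partial>P) \<longlongrightarrow> (\<Sum>ks\<in>?B. f ks))
      (finite_subsets_at_top (Delta n))"
    by (rule tendsto_eventually)
  moreover have "((\<lambda>A. \<integral>w. chaos_sum p f A w * walsh p B w \<partial>P)
      \<longlongrightarrow> (\<integral>w. multint p n f w * walsh p B w \<partial>P)) (finite_subsets_at_top (Delta n))"
    by (intro L2_tendsto_inner L2_tendsto_multint L2_walsh B)
  ultimately have "(\<integral>w. multint p n f w * walsh p B w \<partial>P) = (\<Sum>ks\<in>?B. f ks)"
    using tendsto_unique finite_subsets_at_top_neq_bot by blast
  then show ?thesis
    unfolding permutations_of_set_Int_Delta[OF B] by simp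
qed

end

end

section \<open>Integration of unordered series\<close>

text \<open>Extension by zero outside the image of I turns a sum over a countable type into one over
  the naturals, so that facts on series apply to sums over pairs.\<close>

lemma
  fixes \<phi> :: "'i::countable \<Rightarrow> real"
  shows summable_on_to_nat: "\<phi> summable_on I
      \<longleftrightarrow> (\<lambda>n. if n \<in> to_nat ` I then \<phi> (from_nat n) else 0) summable_on UNIV"
    and infsum_to_nat: "infsum \<phi> I
      = infsum (\<lambda>n. if n \<in> to_nat ` I then \<phi> (from_nat n) else 0) UNIV"
proof -
  have bij: "bij_betw to_nat I (to_nat ` I)"
    by (simp add: bij_betw_def inj_on_def)
  show "\<phi> summable_on I
      \<longleftrightarrow> (\<lambda>n. if n \<in> to_nat ` I then \<phi> (from_nat n) else 0) summable_on UNIV"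
    using summable_on_reindex_bij_betw[OF bij, of "\<lambda>n. \<phi> (from_nat n)"]
      summable_on_cong_neutral[of UNIV "to_nat ` I"
        "\<lambda>n. if n \<in> to_nat ` I then \<phi> (from_nat n) else 0" "\<lambda>n. \<phi> (from_nat n)"]
    by simp
  show "infsum \<phi> I = infsum (\<lambda>n. if n \<in> to_nat ` I then \<phi> (from_nat n) else 0) UNIV"
    using infsum_reindex_bij_betw[OF bij, of "\<lambda>n. \<phi> (from_nat n)"]
      infsum_cong_neutral[of UNIV "to_nat ` I"
        "\<lambda>n. if n \<in> to_nat ` I then \<phi> (from_nat n) else 0" "\<lambda>n. \<phi> (from_nat n)"]
    by simp
qed

text \<open>Unordered summability of reals is absolute summability, and \<open>infsum\<close> takes
  the default value 0 where it fails. The explicit case distinction makes it possible to prove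
  measurability of such a sum in a parameter.\<close>

lemma infsum_nat_real: "infsum \<phi> UNIV = (if summable (\<lambda>n. \<bar>\<phi> n\<bar>) then suminf \<phi> else 0)"
  for \<phi> :: "nat \<Rightarrow> real"
proof (cases "summable (\<lambda>n. \<bar>\<phi> n\<bar>)")
  case True
  then have "(\<phi> has_sum suminf \<phi>) UNIV"
    using norm_summable_imp_has_sum[of \<phi>] summable_rabs_cancel[of \<phi>] by (simp add: summable_sums)
  with True show ?thesis by (simp add: infsumI)
next
  case False
  then have "\<not> \<phi> summable_on UNIV"
    using summable_on_iff_abs_summable_on_real[of \<phi> UNIV]
      summable_on_UNIV_nonneg_real_iff[of "\<lambda>n. \<bar>\<phi> n\<bar>"] by simp
  with False show ?thesis by (simp add: infsum_not_exists)
qed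

text \<open>Tonelli for the absolute values yields absolute convergence almost everywhere, where
  \<open>infsum\<close> and \<open>suminf\<close> agree; the facts on integrals of ordinary series
  then carry over.\<close>

lemma
  fixes g :: "nat \<Rightarrow> 'a \<Rightarrow> real"
  assumes int: "\<And>n. integrable M (g n)" and sum: "summable (\<lambda>n. \<integral>x. \<bar>g n x\<bar> \<partial>M)"
  shows AE_summable_of_summable_integrals: "AE x in M. summable (\<lambda>n. \<bar>g n x\<bar>)"
    and integrable_infsum_nat: "integrable M (\<lambda>x. \<Sum>\<^sub>\<infinity>n. g n x)"
    and integral_infsum_nat: "(\<integral>x. (\<Sum>\<^sub>\<infinity>n. g n x) \<partial>M) = (\<Sum>\<^sub>\<infinity>n. \<integral>x. g n x \<partial>M)"
proof -
  have [measurable]: "g n \<in> borel_measurable M" for n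
    using int by simp
  have "(\<integral>\<^sup>+x. (\<Sum>n. ennreal \<bar>g n x\<bar>) \<partial>M) = (\<Sum>n. \<integral>\<^sup>+x. ennreal \<bar>g n x\<bar> \<partial>M)"
    by (rule nn_integral_suminf) measurable
  also have "\<dots> = (\<Sum>n. ennreal (\<integral>x. \<bar>g n x\<bar> \<partial>M))"
    using int by (intro suminf_cong nn_integral_eq_integral) auto
  also have "\<dots> = ennreal (\<Sum>n. \<integral>x. \<bar>g n x\<bar> \<partial>M)"
    using sum by (intro suminf_ennreal2) auto
  finally have "(\<integral>\<^sup>+x. (\<Sum>n. ennreal \<bar>g n x\<bar>) \<partial>M) \<noteq> \<infinity>" by simp
  then have "AE x in M. (\<Sum>n. ennreal \<bar>g n x\<bar>) \<noteq> \<infinity>"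
    by (intro nn_integral_noteq_infinite) measurable
  then show AE: "AE x in M. summable (\<lambda>n. \<bar>g n x\<bar>)"
    by eventually_elim (auto intro: summable_suminf_not_top)
  have int_sum: "integrable M (\<lambda>x. \<Sum>n. g n x)"
    and integral_sum: "(\<integral>x. (\<Sum>n. g n x) \<partial>M) = (\<Sum>n. \<integral>x. g n x \<partial>M)"
    using integrable_suminf[OF int] integral_suminf[OF int] AE sum by simp_all
  \<comment> \<open>The points of absolute convergence are those with a finite
    \<open>ennreal\<close> sum. This set is measurable, and with it the case distinction in
    \<open>infsum_nat_real\<close>.\<close>
  have "{x \<in> space M. summable (\<lambda>n. \<bar>g n x\<bar>)} = {x \<in> space M. (\<Sum>n. ennreal \<bar>g n x\<bar>) \<noteq> top}"
    by (auto intro: summable_suminf_not_top simp: suminf_ennreal2)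
  then have [measurable]: "Measurable.pred M (\<lambda>x. summable (\<lambda>n. \<bar>g n x\<bar>))"
    unfolding pred_def by auto
  have eq: "AE x in M. (\<Sum>\<^sub>\<infinity>n. g n x) = (\<Sum>n. g n x)"
    using AE by eventually_elim (simp add: infsum_nat_real)
  have meas: "(\<lambda>x. \<Sum>\<^sub>\<infinity>n. g n x) \<in> borel_measurable M"
    unfolding infsum_nat_real by measurable
  show "integrable M (\<lambda>x. \<Sum>\<^sub>\<infinity>n. g n x)"
    using integrable_cong_AE[OF meas _ eq] int_sum by simp
  have "(\<integral>x. (\<Sum>\<^sub>\<infinity>n. g n x) \<partial>M) = (\<Sum>n. \<integral>x. g n x \<partial>M)"
    using integral_cong_AE[OF meas _ eq] integral_sum by simp
  also have "\<dots> = (\<Sum>\<^sub>\<infinity>n. \<integral>x. g n x \<partial>M)"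
  proof -
    have "summable (\<lambda>n. \<bar>\<integral>x. g n x \<partial>M\<bar>)"
      by (rule summable_comparison_test'[OF sum, of 0]) (simp add: integral_abs_bound)
    then show ?thesis by (simp add: infsum_nat_real)
  qed
  finally show "(\<integral>x. (\<Sum>\<^sub>\<infinity>n. g n x) \<partial>M) = (\<Sum>\<^sub>\<infinity>n. \<integral>x. g n x \<partial>M)" .
qed

lemma
  fixes g :: "'i::countable \<Rightarrow> 'a \<Rightarrow> real"
  assumes int: "\<And>i. i \<in> I \<Longrightarrow> integrable M (g i)"
    and sum: "(\<lambda>i. \<integral>x. \<bar>g i x\<bar> \<partial>M) summable_on I"
  shows AE_summable_on: "AE x in M. (\<lambda>i. g i x) summable_on I"
    and integrable_infsum: "integrable M (\<lambda>x. \<Sum>\<^sub>\<infinity>i\<in>I. g i x)"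
    and integral_infsum: "(\<integral>x. (\<Sum>\<^sub>\<infinity>i\<in>I. g i x) \<partial>M) = (\<Sum>\<^sub>\<infinity>i\<in>I. \<integral>x. g i x \<partial>M)"
proof -
  define h where "h n x = (if n \<in> to_nat ` I then g (from_nat n) x else 0)" for n x
  have h: "integrable M (h n)" for n
  proof (cases "n \<in> to_nat ` I")
    case True
    then obtain i where "i \<in> I" "n = to_nat i" by (rule imageE)
    then show ?thesis using int by (simp add: h_def[abs_def])
  qed (simp add: h_def[abs_def])
  have "(\<lambda>n. if n \<in> to_nat ` I then \<integral>x. \<bar>g (from_nat n) x\<bar> \<partial>M else 0) summable_on UNIV"
    using sum summable_on_to_nat[of "\<lambda>i. \<integral>x. \<bar>g i x\<bar> \<partial>M" I] by (rule iffD1[rotated])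
  also have "(\<lambda>n. if n \<in> to_nat ` I then \<integral>x. \<bar>g (from_nat n) x\<bar> \<partial>M else 0) = (\<lambda>n. \<integral>x. \<bar>h n x\<bar> \<partial>M)"
    by (intro ext) (simp add: h_def)
  finally have h_sum: "summable (\<lambda>n. \<integral>x. \<bar>h n x\<bar> \<partial>M)"
    by (simp add: summable_on_UNIV_nonneg_real_iff)
  have infsum_h: "(\<Sum>\<^sub>\<infinity>i\<in>I. g i x) = (\<Sum>\<^sub>\<infinity>n. h n x)" for x
    unfolding h_def by (rule infsum_to_nat)
  show "AE x in M. (\<lambda>i. g i x) summable_on I"
    using AE_summable_of_summable_integrals[OF h h_sum]
  proof eventually_elim
    case (elim x)
    then have "(\<lambda>n. h n x) summable_on UNIV"
      by (intro norm_summable_imp_summable_on) simp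
    then show ?case
      using summable_on_to_nat[of "\<lambda>i. g i x" I] unfolding h_def by (rule iffD2[rotated])
  qed
  show "integrable M (\<lambda>x. \<Sum>\<^sub>\<infinity>i\<in>I. g i x)"
    unfolding infsum_h by (rule integrable_infsum_nat[OF h h_sum])
  have "(\<integral>x. h n x \<partial>M) = (if n \<in> to_nat ` I then \<integral>x. g (from_nat n) x \<partial>M else 0)" for n
    by (simp add: h_def)
  then have "(\<Sum>\<^sub>\<infinity>i\<in>I. \<integral>x. g i x \<partial>M) = (\<Sum>\<^sub>\<infinity>n. \<integral>x. h n x \<partial>M)"
    by (subst infsum_to_nat) simp
  then show "(\<integral>x. (\<Sum>\<^sub>\<infinity>i\<in>I. g i x) \<partial>M) = (\<Sum>\<^sub>\<infinity>i\<in>I. \<integral>x. g i x \<partial>M)"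
    unfolding infsum_h using integral_infsum_nat[OF h h_sum] by simp
qed

section \<open>Symmetrization\<close>

definition move_to_end :: "nat \<Rightarrow> 'a list \<Rightarrow> 'a list" where
  "move_to_end i ks = take i ks @ drop (Suc i) ks @ [ks ! i]"

lemma symmetrization_move_to_end:
  "symmetrization n f ks = (\<Sum>i<Suc n. f (move_to_end i ks)) / real (Suc n)"
  by (simp add: symmetrization_def move_to_end_def)

lemma mset_move_to_end: "i < length ks \<Longrightarrow> mset (move_to_end i ks) = mset ks"
  using arg_cong[OF id_take_nth_drop[of i ks], of mset] by (simp add: move_to_end_def)

text \<open>The first i entries are left in place, and what follows them determines both the tail
  and the entry that was moved.\<close>

lemma inj_on_move_to_end: "inj_on (move_to_end i) {ks. i < length ks}"
proof (rule inj_onI, safe)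
  fix ks ls :: "'a list"
  assume i: "i < length ks" "i < length ls" and eq: "move_to_end i ks = move_to_end i ls"
  have take: "take i ks = take i ls"
    using arg_cong[OF eq, of "take i"] i by (simp add: move_to_end_def)
  moreover have "drop (Suc i) ks @ [ks ! i] = drop (Suc i) ls @ [ls ! i]"
    using eq take by (simp add: move_to_end_def)
  ultimately show "ks = ls"
    using id_take_nth_drop[OF i(1)] id_take_nth_drop[OF i(2)] by simp
qed

lemma move_to_end_permutations_of_set:
  assumes "finite B" "i < card B"
  shows "bij_betw (move_to_end i) (permutations_of_set B) (permutations_of_set B)"
proof -
  have len: "length ks = card B" if "ks \<in> permutations_of_set B" for ks
    using that by (auto simp: permutations_of_set_def distinct_card)
  have inj: "inj_on (move_to_end i) (permutations_of_set B)"
    by (rule inj_on_subset[OF inj_on_move_to_end]) (use assms len in auto)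
  have "move_to_end i ks \<in> permutations_of_set B" if ks: "ks \<in> permutations_of_set B" for ks
  proof -
    have "mset (move_to_end i ks) = mset ks"
      using assms len[OF ks] by (intro mset_move_to_end) simp
    then have "set (move_to_end i ks) = set ks" "distinct (move_to_end i ks) = distinct ks"
      by (metis set_mset_mset, metis mset_eq_imp_distinct_iff)
    with ks show ?thesis by (simp add: permutations_of_set_def)
  qed
  then have "move_to_end i ` permutations_of_set B = permutations_of_set B"
    by (intro endo_inj_surj inj) auto
  with inj show ?thesis by (simp add: bij_betw_def)
qed

text \<open>Each of the n + 1 moves permutes the orderings of B, so the sums being averaged
  coincide. In view of \<open>integral_multint_walsh\<close>, the coefficients of the divergence can
  be computed from the unsymmetrized kernel.\<close>

lemma sum_symmetrization_permutations:
  assumes "finite B" "card B = Suc n"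
  shows "(\<Sum>ks\<in>permutations_of_set B. symmetrization n f ks) = (\<Sum>ks\<in>permutations_of_set B. f ks)"
proof -
  have "(\<Sum>ks\<in>permutations_of_set B. symmetrization n f ks)
      = (\<Sum>i<Suc n. \<Sum>ks\<in>permutations_of_set B. f (move_to_end i ks)) / real (Suc n)"
    unfolding symmetrization_move_to_end
    by (subst sum.swap) (simp only: sum_divide_distrib)
  also have "(\<Sum>i<Suc n. \<Sum>ks\<in>permutations_of_set B. f (move_to_end i ks))
      = (\<Sum>i<Suc n. \<Sum>ks\<in>permutations_of_set B. f ks)"
    using assms by (intro sum.cong refl sum.reindex_bij_betw move_to_end_permutations_of_set) auto
  finally show ?thesis by simp
qed

text \<open>The last variable of a kernel is the time index of the process. Splitting by it relates
  the coefficient of the divergence at B to those of the components \<open>u l\<close> at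
  \<open>B - {l}\<close>.\<close>

lemma sum_permutations_by_last:
  assumes "finite B" "B \<noteq> {}"
  shows "(\<Sum>ks\<in>permutations_of_set B. f ks) = (\<Sum>l\<in>B. \<Sum>ls\<in>permutations_of_set (B - {l}). f (ls @ [l]))"
proof -
  have "(\<Sum>l\<in>B. \<Sum>ls\<in>permutations_of_set (B - {l}). f (ls @ [l]))
      = (\<Sum>(l, ls)\<in>(SIGMA l:B. permutations_of_set (B - {l})). f (ls @ [l]))"
    using assms(1) by (intro sum.Sigma) auto
  also have "\<dots> = (\<Sum>ks\<in>permutations_of_set B. f ks)"
  proof (rule sum.reindex_bij_witness[where i = "\<lambda>ks. (last ks, butlast ks)" and j = "\<lambda>(l, ls). ls @ [l]"])
    fix ks assume ks: "ks \<in> permutations_of_set B"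
    then have "ks \<noteq> []" using assms(2) by (auto simp: permutations_of_set_def)
    then obtain l ls where "ks = ls @ [l]" by (metis rev_exhaust)
    with ks show "(last ks, butlast ks) \<in> (SIGMA l:B. permutations_of_set (B - {l}))"
      "(case (last ks, butlast ks) of (l, ls) \<Rightarrow> ls @ [l]) = ks"
      by (auto simp: permutations_of_set_def)
  next
    fix a assume "a \<in> (SIGMA l:B. permutations_of_set (B - {l}))"
    then obtain l ls where a: "a = (l, ls)" "l \<in> B" "set ls = B - {l}" "distinct ls"
      by (auto simp: permutations_of_set_def)
    show "(last (case a of (l, ls) \<Rightarrow> ls @ [l]), butlast (case a of (l, ls) \<Rightarrow> ls @ [l])) = a"
      "f (case a of (l, ls) \<Rightarrow> ls @ [l]) = (case a of (l, ls) \<Rightarrow> f (ls @ [l]))"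
      by (simp_all add: a(1))
    show "(case a of (l, ls) \<Rightarrow> ls @ [l]) \<in> permutations_of_set B"
      using a by (simp add: permutations_of_set_def insert_absorb)
  qed
  finally show ?thesis by (rule sym)
qed

section \<open>Square-summability of symmetrized kernels and of kernel sections\<close>

lemma kernels_summable: "f \<in> kernels j \<Longrightarrow> (\<lambda>ks. (f ks)\<^sup>2) summable_on {ks. length ks = Suc j}"
  by (simp add: kernels_def)

lemma summable_on_inj_into:
  fixes g :: "'b \<Rightarrow> real"
  assumes "g summable_on T" "inj_on h S" "h ` S \<subseteq> T"
  shows "(\<lambda>x. g (h x)) summable_on S"
  using summable_on_subset[OF assms(1,3)] unfolding summable_on_reindex[OF assms(2)] o_def .

text \<open>The square of an average is at most the sum of the squares, and each move is an
  injection into the lists over which f is square-summable.\<close>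

lemma symmetrization_summable:
  assumes "f \<in> kernels j"
  shows "(\<lambda>ks. (symmetrization j f ks)\<^sup>2) summable_on Delta (Suc j)"
proof (rule summable_on_comparison_test)
  have "(\<lambda>ks. (f (move_to_end i ks))\<^sup>2) summable_on Delta (Suc j)" if "i < Suc j" for i
    using kernels_summable[OF assms]
  proof (rule summable_on_inj_into)
    show "inj_on (move_to_end i) (Delta (Suc j))"
      by (rule inj_on_subset[OF inj_on_move_to_end]) (use that in \<open>auto simp: Delta_def\<close>)
    show "move_to_end i ` Delta (Suc j) \<subseteq> {ks. length ks = Suc j}"
      using that by (auto simp: Delta_def move_to_end_def)
  qed
  then have "(\<lambda>ks. \<Sum>i<m. (f (move_to_end i ks))\<^sup>2) summable_on Delta (Suc j)" if "m \<le> Suc j" for m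
    using that by (induction m) (auto intro!: summable_on_add)
  then show "(\<lambda>ks. \<Sum>i<Suc j. (f (move_to_end i ks))\<^sup>2) summable_on Delta (Suc j)"
    by blast
  show "(symmetrization j f ks)\<^sup>2 \<le> (\<Sum>i<Suc j. (f (move_to_end i ks))\<^sup>2)" for ks
  proof -
    \<comment> \<open>The factor \<open>Suc j\<close> from the Cauchy-Schwarz inequality cancels one
      of the two in the denominator; the other is at least 1.\<close>
    have "(symmetrization j f ks)\<^sup>2 \<le> (\<Sum>i<Suc j. (f (move_to_end i ks))\<^sup>2) * real (Suc j) / (real (Suc j))\<^sup>2"
      unfolding symmetrization_move_to_end power_divide
      using sum_squared_le_sum_of_squares[of "\<lambda>i. f (move_to_end i ks)" "{..<Suc j}"]
      by (intro divide_right_mono) (simp_all only: card_lessThan, simp)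
    also have "\<dots> = (\<Sum>i<Suc j. (f (move_to_end i ks))\<^sup>2) / real (Suc j)"
      by (simp add: power2_eq_square)
    also have "\<dots> \<le> (\<Sum>i<Suc j. (f (move_to_end i ks))\<^sup>2) / 1"
      by (intro divide_left_mono sum_nonneg) auto
    finally show ?thesis by simp
  qed
qed auto

text \<open>Appending k maps pairs of an index and a list of distinct entries injectively into the
  lists of length j + 1. The sum over these pairs can then be taken over the lists first and over k
  last.\<close>

lemma
  assumes "f \<in> kernels j"
  shows kernel_section_summable: "(\<lambda>ks. (f (ks @ [k]))\<^sup>2) summable_on Delta j"
    and kernel_sections_summable: "(\<lambda>k. \<Sum>\<^sub>\<infinity>ks\<in>Delta j. (f (ks @ [k]))\<^sup>2) summable_on UNIV"
proof -
  have "(\<lambda>x. (f ((\<lambda>(k, ks). ks @ [k]) x))\<^sup>2) summable_on (SIGMA k:UNIV. Delta j)"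
    by (rule summable_on_inj_into[OF kernels_summable[OF assms]]) (auto simp: inj_on_def Delta_def)
  then have S: "(\<lambda>(k, ks). (f (ks @ [k]))\<^sup>2) summable_on (SIGMA k:UNIV. Delta j)"
    by (rule back_subst[of "\<lambda>g. g summable_on _"]) auto
  show sec: "(\<lambda>ks. (f (ks @ [k]))\<^sup>2) summable_on Delta j" for k
    using summable_on_SigmaD1[OF S, of k] by simp
  show "(\<lambda>k. \<Sum>\<^sub>\<infinity>ks\<in>Delta j. (f (ks @ [k]))\<^sup>2) summable_on UNIV"
    using summable_on_SigmaD[OF S] sec by simp
qed

section \<open>The divergence\<close>

lemma L2_tendsto_cong_limit:
  assumes S: "L2_tendsto M S F A" and G: "G \<in> L2 M" and eq: "AE w in M. F w = G w"
  shows "L2_tendsto M S G A"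
proof (rule L2_tendstoI_le)
  show "\<forall>\<^sub>F i in A. S i \<in> L2 M" "((\<lambda>i. \<integral>w. (S i w - F w)\<^sup>2 \<partial>M) \<longlongrightarrow> 0) A"
    using L2_tendstoD[OF S] by auto
  show "\<forall>\<^sub>F i in A. (\<integral>w. (S i w - G w)\<^sup>2 \<partial>M) \<le> (\<integral>w. (S i w - F w)\<^sup>2 \<partial>M)"
    using L2_tendstoD(2)[OF S]
  proof eventually_elim
    case (elim i)
    have "AE w in M. (S i w - G w)\<^sup>2 = (S i w - F w)\<^sup>2"
      using eq by eventually_elim simp
    then have "(\<integral>w. (S i w - G w)\<^sup>2 \<partial>M) = (\<integral>w. (S i w - F w)\<^sup>2 \<partial>M)"
      using elim G L2_tendstoD(1)[OF S] by (intro integral_cong_AE) (auto simp: L2_def)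
    then show ?case by simp
  qed
qed (rule G)

lemma sum_off_diagonal:
  fixes e :: "'i \<Rightarrow> 'i \<Rightarrow> real"
  assumes "finite A"
  shows "(\<Sum>k\<in>A. \<Sum>l\<in>A. e k l)
    = (\<Sum>k\<in>A. e k k) + (\<Sum>(k, l)\<in>{(k, l). k \<in> A \<and> l \<in> A \<and> k \<noteq> l}. e k l)"
proof -
  have "(\<Sum>k\<in>A. \<Sum>l\<in>A. e k l) = (\<Sum>(k, l)\<in>A \<times> A. e k l)"
    by (rule sum.cartesian_product)
  also have "A \<times> A = (\<lambda>k. (k, k)) ` A \<union> {(k, l). k \<in> A \<and> l \<in> A \<and> k \<noteq> l}"
    by auto
  also have "(\<Sum>(k, l)\<in>\<dots>. e k l) = (\<Sum>(k, l)\<in>(\<lambda>k. (k, k)) ` A. e k l)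
      + (\<Sum>(k, l)\<in>{(k, l). k \<in> A \<and> l \<in> A \<and> k \<noteq> l}. e k l)"
    using assms by (intro sum.union_disjoint finite_subset[of "{(k, l). k \<in> A \<and> l \<in> A \<and> k \<noteq> l}" "A \<times> A"]) auto
  also have "(\<Sum>(k, l)\<in>(\<lambda>k. (k, k)) ` A. e k l) = (\<Sum>k\<in>A. e k k)"
    by (subst sum.reindex) (auto simp: inj_on_def)
  finally show ?thesis .
qed

context bernoulli
begin

lemma walsh_coefficients_unique:
  assumes F: "F \<in> L2 P" and G: "G \<in> L2 P"
    and eq: "\<And>B. finite B \<Longrightarrow> (\<integral>w. F w * walsh p B w \<partial>P) = (\<integral>w. G w * walsh p B w \<partial>P)"
  shows "AE w in P. F w = G w"
proof -
  have "AE w in P. F w - G w = 0"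
  proof (rule walsh_complete[OF L2_diff[OF F G]])
    fix B :: "nat set" assume B: "finite B"
    show "(\<integral>w. (F w - G w) * walsh p B w \<partial>P) = 0"
      using eq[OF B] L2_integrable_mult[OF F L2_walsh[OF B]] L2_integrable_mult[OF G L2_walsh[OF B]]
      by (simp add: left_diff_distrib)
  qed
  then show ?thesis by simp
qed

text \<open>The isometry before any limit is taken. Both the convergence estimate for the combined
  terms and claim (ii) start from this identity.\<close>

lemma integral_summands_square:
  assumes u: "\<And>k. u k \<in> L2 P" and A: "finite A"
  shows "(\<integral>w. (\<Sum>k\<in>A. summand k (u k) w)\<^sup>2 \<partial>P)
    = (\<Sum>k\<in>A. (\<integral>w. (u k w)\<^sup>2 \<partial>P) - (\<integral>w. (D k (u k) w)\<^sup>2 \<partial>P))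
      + (\<Sum>(k, l)\<in>{(k, l). k \<in> A \<and> l \<in> A \<and> k \<noteq> l}. \<integral>w. D k (u l) w * D l (u k) w \<partial>P)"
proof -
  have "(\<integral>w. (\<Sum>k\<in>A. summand k (u k) w)\<^sup>2 \<partial>P)
      = (\<Sum>k\<in>A. \<Sum>l\<in>A. \<integral>w. summand k (u k) w * summand l (u l) w \<partial>P)"
    using L2_integrable_mult[OF L2_summand[OF u] L2_summand[OF u]]
    by (simp add: power2_eq_square sum_product Bochner_Integration.integral_sum)
  also have "\<dots> = (\<Sum>k\<in>A. \<integral>w. summand k (u k) w * summand k (u k) w \<partial>P)
      + (\<Sum>(k, l)\<in>{(k, l). k \<in> A \<and> l \<in> A \<and> k \<noteq> l}. \<integral>w. summand k (u k) w * summand l (u l) w \<partial>P)"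
    by (rule sum_off_diagonal[OF A])
  also have "(\<Sum>k\<in>A. \<integral>w. summand k (u k) w * summand k (u k) w \<partial>P)
      = (\<Sum>k\<in>A. (\<integral>w. (u k w)\<^sup>2 \<partial>P) - (\<integral>w. (D k (u k) w)\<^sup>2 \<partial>P))"
    using integral_summand_square[OF u] by (simp add: power2_eq_square)
  also have "(\<Sum>(k, l)\<in>{(k, l). k \<in> A \<and> l \<in> A \<and> k \<noteq> l}. \<integral>w. summand k (u k) w * summand l (u l) w \<partial>P)
      = (\<Sum>(k, l)\<in>{(k, l). k \<in> A \<and> l \<in> A \<and> k \<noteq> l}. \<integral>w. D k (u l) w * D l (u k) w \<partial>P)"
    by (intro sum.cong refl) (auto intro!: integral_summand_mult u)
  finally show ?thesis .
qed

section \<open>Processes with a finite chaos expansion\<close>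

context
  fixes n :: nat and f :: "nat \<Rightarrow> nat list \<Rightarrow> real" and u :: "nat \<Rightarrow> (nat \<Rightarrow> real) \<Rightarrow> real"
  assumes ex: "chaos_expansion p n f u"
begin

text \<open>\<open>Suc n\<close> pays for the Cauchy-Schwarz inequality over the n + 1 degrees.
  \<open>Suc j\<close> dominates both the factor 1 in the estimate of E[(u l)^2] and the factor j in
  the gradient estimate, so that one bound serves for both.\<close>

definition energy_bound :: "nat \<Rightarrow> real" where
  "energy_bound l = real (Suc n) *
     (\<Sum>j\<le>n. real (Suc j) * (fact j * (\<Sum>\<^sub>\<infinity>ks\<in>Delta j. (f j (ks @ [l]))\<^sup>2)))"

lemma kernel: "j \<le> n \<Longrightarrow> f j \<in> kernels j"
  using ex by (simp add: chaos_expansion_def)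

lemma expansion: "AE w in P. u k w = (\<Sum>j\<le>n. multint p j (\<lambda>ks. f j (ks @ [k])) w)"
  using ex by (simp add: chaos_expansion_def)

lemma L2_component: "j \<le> n \<Longrightarrow> multint p j (\<lambda>ks. f j (ks @ [k])) \<in> L2 P"
  by (intro L2_multint kernel_section_summable kernel)

lemma L2_expansion: "(\<lambda>w. \<Sum>j\<le>n. multint p j (\<lambda>ks. f j (ks @ [k])) w) \<in> L2 P"
  by (intro L2_sum L2_component) auto

lemma L2_process: "u k \<in> L2 P"
  using L2_cong_AE[OF L2_expansion _ expansion] ex by (simp add: chaos_expansion_def)

lemma energy_bound_summable: "energy_bound summable_on UNIV"
proof -
  have "(\<lambda>l. \<Sum>j<m. real (Suc j) * (fact j * (\<Sum>\<^sub>\<infinity>ks\<in>Delta j. (f j (ks @ [l]))\<^sup>2))) summable_on UNIV"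
    if "m \<le> Suc n" for m
    using that
    by (induction m) (auto intro!: summable_on_add summable_on_cmult_right kernel_sections_summable kernel)
  from summable_on_cmult_right[OF this[of "Suc n"]] show ?thesis
    unfolding energy_bound_def[abs_def] lessThan_Suc_atMost by simp
qed

lemma energy_bound_nonneg: "0 \<le> energy_bound l"
  unfolding energy_bound_def by (intro mult_nonneg_nonneg sum_nonneg infsum_nonneg) auto

lemma integral_process_square_le: "(\<integral>w. (u l w)\<^sup>2 \<partial>P) \<le> energy_bound l"
proof -
  have "AE w in P. (u l w)\<^sup>2 = (\<Sum>j\<le>n. multint p j (\<lambda>ks. f j (ks @ [l])) w)\<^sup>2"
    using expansion[of l] by eventually_elim simp
  then have "(\<integral>w. (u l w)\<^sup>2 \<partial>P) = (\<integral>w. (\<Sum>j\<le>n. multint p j (\<lambda>ks. f j (ks @ [l])) w)\<^sup>2 \<partial>P)"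
    using L2_process[of l] L2_expansion[of l] by (intro integral_cong_AE) (auto simp: L2_def)
  also have "\<dots> \<le> real (Suc n) * (\<Sum>j\<le>n. \<integral>w. (multint p j (\<lambda>ks. f j (ks @ [l])) w)\<^sup>2 \<partial>P)"
    using L2_integral_sum_square_le[of "{..n}" "\<lambda>j. multint p j (\<lambda>ks. f j (ks @ [l]))" P] L2_component
    by simp
  also have "\<dots> \<le> energy_bound l"
    unfolding energy_bound_def
  proof (intro mult_left_mono sum_mono)
    fix j assume "j \<in> {..n}"
    then have "(\<integral>w. (multint p j (\<lambda>ks. f j (ks @ [l])) w)\<^sup>2 \<partial>P)
        \<le> 1 * (fact j * (\<Sum>\<^sub>\<infinity>ks\<in>Delta j. (f j (ks @ [l]))\<^sup>2))"
      using integral_multint_square_le[OF kernel_section_summable[OF kernel]] by simp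
    also have "\<dots> \<le> real (Suc j) * (fact j * (\<Sum>\<^sub>\<infinity>ks\<in>Delta j. (f j (ks @ [l]))\<^sup>2))"
      by (intro mult_right_mono mult_nonneg_nonneg infsum_nonneg) auto
    finally show "(\<integral>w. (multint p j (\<lambda>ks. f j (ks @ [l])) w)\<^sup>2 \<partial>P)
        \<le> real (Suc j) * (fact j * (\<Sum>\<^sub>\<infinity>ks\<in>Delta j. (f j (ks @ [l]))\<^sup>2))" .
  qed simp
  finally show ?thesis .
qed

lemma sum_integral_D_process_le:
  assumes "finite K"
  shows "(\<Sum>k\<in>K. \<integral>w. (D k (u l) w)\<^sup>2 \<partial>P) \<le> energy_bound l"
proof -
  let ?J = "\<lambda>j. multint p j (\<lambda>ks. f j (ks @ [l]))"
  have "(\<integral>w. (D k (u l) w)\<^sup>2 \<partial>P) \<le> real (Suc n) * (\<Sum>j\<le>n. \<integral>w. (D k (?J j) w)\<^sup>2 \<partial>P)" for k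
  proof -
    have "AE w in P. (D k (u l) w)\<^sup>2 = (\<Sum>j\<le>n. D k (?J j) w)\<^sup>2"
      using D_cong_AE[OF expansion, of k l] by eventually_elim (simp add: grad_sum)
    then have "(\<integral>w. (D k (u l) w)\<^sup>2 \<partial>P) = (\<integral>w. (\<Sum>j\<le>n. D k (?J j) w)\<^sup>2 \<partial>P)"
      using L2_D[OF L2_process[of l], of k] L2_sum[of "{..n}" "\<lambda>j. D k (?J j)" P] L2_D[OF L2_component]
      by (intro integral_cong_AE) (auto simp: L2_def)
    also have "\<dots> \<le> real (Suc n) * (\<Sum>j\<le>n. \<integral>w. (D k (?J j) w)\<^sup>2 \<partial>P)"
      using L2_integral_sum_square_le[of "{..n}" "\<lambda>j. D k (?J j)" P] L2_D[OF L2_component]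
      by simp
    finally show ?thesis .
  qed
  then have "(\<Sum>k\<in>K. \<integral>w. (D k (u l) w)\<^sup>2 \<partial>P)
      \<le> (\<Sum>k\<in>K. real (Suc n) * (\<Sum>j\<le>n. \<integral>w. (D k (?J j) w)\<^sup>2 \<partial>P))"
    by (rule sum_mono)
  also have "\<dots> = real (Suc n) * (\<Sum>j\<le>n. \<Sum>k\<in>K. \<integral>w. (D k (?J j) w)\<^sup>2 \<partial>P)"
    unfolding sum_distrib_left[symmetric] by (subst sum.swap) (rule refl)
  also have "\<dots> \<le> energy_bound l"
    unfolding energy_bound_def
  proof (intro mult_left_mono sum_mono)
    fix j assume "j \<in> {..n}"
    then have "(\<Sum>k\<in>K. \<integral>w. (D k (?J j) w)\<^sup>2 \<partial>P)
        \<le> real j * (fact j * (\<Sum>\<^sub>\<infinity>ks\<in>Delta j. (f j (ks @ [l]))\<^sup>2))"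
      by (intro sum_integral_D_multint_le kernel_section_summable kernel assms) simp
    also have "\<dots> \<le> real (Suc j) * (fact j * (\<Sum>\<^sub>\<infinity>ks\<in>Delta j. (f j (ks @ [l]))\<^sup>2))"
      by (intro mult_right_mono mult_nonneg_nonneg infsum_nonneg) auto
    finally show "(\<Sum>k\<in>K. \<integral>w. (D k (?J j) w)\<^sup>2 \<partial>P)
        \<le> real (Suc j) * (fact j * (\<Sum>\<^sub>\<infinity>ks\<in>Delta j. (f j (ks @ [l]))\<^sup>2))" .
  qed simp
  finally show ?thesis .
qed

text \<open>One energy bound pays for the diagonal and one for the off-diagonal part, which explains
  the constant 2. Off the diagonal a b \<le> a^2 / 2 + b^2 / 2; the two resulting double sums agree
  after exchanging the indices, and each is at most half the total of the energy bounds.\<close>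

lemma integral_summands_square_le:
  assumes A: "finite A"
  shows "(\<integral>w. (\<Sum>k\<in>A. summand k (u k) w)\<^sup>2 \<partial>P) \<le> (\<Sum>k\<in>A. 2 * energy_bound k)"
proof -
  let ?\<beta> = "\<lambda>k l. \<integral>w. (D k (u l) w)\<^sup>2 \<partial>P"
  have pair: "(\<integral>w. D k (u l) w * D l (u k) w \<partial>P) \<le> ?\<beta> k l / 2 + ?\<beta> l k / 2" for k l
  proof -
    have "(\<integral>w. D k (u l) w * D l (u k) w \<partial>P) \<le> (\<integral>w. (D k (u l) w)\<^sup>2 / 2 + (D l (u k) w)\<^sup>2 / 2 \<partial>P)"
    proof (rule integral_mono)
      show "D k (u l) w * D l (u k) w \<le> (D k (u l) w)\<^sup>2 / 2 + (D l (u k) w)\<^sup>2 / 2" for w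
        using sum_squares_bound[of "D k (u l) w" "D l (u k) w"] by simp
    qed (auto intro!: L2_integrable_mult L2_integrable_square L2_D L2_process)
    then show ?thesis
      using L2_integrable_square[OF L2_D[OF L2_process]] by simp
  qed
  have half: "(\<Sum>k\<in>A. \<Sum>l\<in>A. ?\<beta> k l / 2) \<le> (\<Sum>l\<in>A. energy_bound l / 2)"
    by (subst sum.swap)
      (auto intro!: sum_mono divide_right_mono sum_integral_D_process_le A simp flip: sum_divide_distrib)
  have "(\<Sum>(k, l)\<in>{(k, l). k \<in> A \<and> l \<in> A \<and> k \<noteq> l}. \<integral>w. D k (u l) w * D l (u k) w \<partial>P)
      \<le> (\<Sum>(k, l)\<in>{(k, l). k \<in> A \<and> l \<in> A \<and> k \<noteq> l}. ?\<beta> k l / 2 + ?\<beta> l k / 2)"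
    by (intro sum_mono) (auto intro: pair)
  \<comment> \<open>The diagonal terms added here are nonnegative, so completing the index set to a
    square can only increase the sum.\<close>
  also have "\<dots> \<le> (\<Sum>k\<in>A. \<Sum>l\<in>A. ?\<beta> k l / 2 + ?\<beta> l k / 2)"
    unfolding sum_off_diagonal[OF A] by (simp add: sum_nonneg)
  also have "\<dots> = (\<Sum>k\<in>A. \<Sum>l\<in>A. ?\<beta> k l / 2) + (\<Sum>l\<in>A. \<Sum>k\<in>A. ?\<beta> k l / 2)"
    by (simp add: sum.distrib)
  also have "\<dots> = (\<Sum>k\<in>A. \<Sum>l\<in>A. ?\<beta> k l / 2) + (\<Sum>k\<in>A. \<Sum>l\<in>A. ?\<beta> k l / 2)"
    by (subst (2) sum.swap) (rule refl)
  also have "\<dots> \<le> (\<Sum>l\<in>A. energy_bound l)"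
    using half by (simp flip: sum_divide_distrib)
  finally have off: "(\<Sum>(k, l)\<in>{(k, l). k \<in> A \<and> l \<in> A \<and> k \<noteq> l}. \<integral>w. D k (u l) w * D l (u k) w \<partial>P)
      \<le> (\<Sum>l\<in>A. energy_bound l)" .
  have "(\<integral>w. (u k w)\<^sup>2 \<partial>P) - (\<integral>w. (D k (u k) w)\<^sup>2 \<partial>P) \<le> energy_bound k" for k
  proof -
    have "0 \<le> (\<integral>w. (D k (u k) w)\<^sup>2 \<partial>P)" by simp
    then show ?thesis using integral_process_square_le[of k] by linarith
  qed
  then have "(\<Sum>k\<in>A. (\<integral>w. (u k w)\<^sup>2 \<partial>P) - (\<integral>w. (D k (u k) w)\<^sup>2 \<partial>P)) \<le> (\<Sum>k\<in>A. energy_bound k)"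
    by (rule sum_mono)
  with off show ?thesis
    unfolding integral_summands_square[OF L2_process A] by (simp flip: sum_distrib_left)
qed

text \<open>The product over B is orthogonal to every degree except \<open>card B\<close>, and that
  degree occurs in the expansion when \<open>card B \<le> n\<close>.\<close>

lemma integral_process_walsh:
  assumes B: "finite B"
  shows "(\<integral>w. u l w * walsh p B w \<partial>P)
    = (if card B \<le> n then \<Sum>ls\<in>permutations_of_set B. f (card B) (ls @ [l]) else 0)"
proof -
  have "AE w in P. u l w * walsh p B w = (\<Sum>j\<le>n. multint p j (\<lambda>ks. f j (ks @ [l])) w * walsh p B w)"
    using expansion[of l] by eventually_elim (simp add: sum_distrib_right)
  then have "(\<integral>w. u l w * walsh p B w \<partial>P)
      = (\<integral>w. (\<Sum>j\<le>n. multint p j (\<lambda>ks. f j (ks @ [l])) w * walsh p B w) \<partial>P)"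
    using L2_measurable[OF L2_process] L2_measurable[OF L2_walsh[OF B]] L2_measurable[OF L2_component]
    by (intro integral_cong_AE borel_measurable_times borel_measurable_sum) auto
  also have "\<dots> = (\<Sum>j\<le>n. \<integral>w. multint p j (\<lambda>ks. f j (ks @ [l])) w * walsh p B w \<partial>P)"
    by (intro Bochner_Integration.integral_sum L2_integrable_mult L2_component L2_walsh B) auto
  also have "\<dots> = (\<Sum>j\<le>n. if j = card B then \<Sum>ls\<in>permutations_of_set B. f j (ls @ [l]) else 0)"
    using B by (intro sum.cong refl) (subst integral_multint_walsh, auto intro!: kernel_section_summable kernel)
  also have "\<dots> = (if card B \<le> n then \<Sum>ls\<in>permutations_of_set B. f (card B) (ls @ [l]) else 0)"
    by (subst sum.delta) auto
  finally show ?thesis .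
qed

text \<open>The divergence computed from the fixed expansion, under its other name of Skorohod
  integral.\<close>

abbreviation "skorohod w \<equiv> \<Sum>j\<le>n. multint p (j + 1) (symmetrization j (f j)) w"

lemma L2_skorohod: "(\<lambda>w. skorohod w) \<in> L2 P"
  by (intro L2_sum) (auto intro!: L2_multint symmetrization_summable kernel)

text \<open>Symmetrization leaves the sum over the orderings of B unchanged, and splitting that sum
  by the last entry recovers the coefficients of the components. The right-hand side refers to the
  process alone, so different expansions give the same divergence almost surely.\<close>

lemma integral_skorohod_walsh:
  assumes B: "finite B"
  shows "(\<integral>w. skorohod w * walsh p B w \<partial>P) = (\<Sum>l\<in>B. \<integral>w. u l w * walsh p (B - {l}) w \<partial>P)"
proof -
  have "(\<integral>w. skorohod w * walsh p B w \<partial>P)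
      = (\<Sum>j\<le>n. \<integral>w. multint p (j + 1) (symmetrization j (f j)) w * walsh p B w \<partial>P)"
    unfolding sum_distrib_right using B
    by (intro Bochner_Integration.integral_sum L2_integrable_mult L2_multint L2_walsh)
      (auto intro!: symmetrization_summable kernel)
  also have "\<dots> = (\<Sum>j\<le>n. if card B = Suc j then \<Sum>ks\<in>permutations_of_set B. f j ks else 0)"
    using B by (intro sum.cong refl)
      (simp add: integral_multint_walsh symmetrization_summable kernel sum_symmetrization_permutations)
  also have "\<dots> = (\<Sum>l\<in>B. \<integral>w. u l w * walsh p (B - {l}) w \<partial>P)"
  proof (cases "card B")
    \<comment> \<open>For empty B no degree \<open>Suc j\<close> matches: the divergence has mean
      zero.\<close>
    case 0
    with B show ?thesis by simp
  next
    case (Suc m)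
    then have "B \<noteq> {}" and card: "\<And>l. l \<in> B \<Longrightarrow> card (B - {l}) = m"
      using B by auto
    have "(\<Sum>j\<le>n. if card B = Suc j then \<Sum>ks\<in>permutations_of_set B. f j ks else 0)
        = (\<Sum>j\<le>n. if j = m then \<Sum>ks\<in>permutations_of_set B. f j ks else 0)"
      using Suc by (intro sum.cong refl) auto
    also have "\<dots> = (if m \<le> n then \<Sum>ks\<in>permutations_of_set B. f m ks else 0)"
      by (subst sum.delta) auto
    also have "\<dots> = (\<Sum>l\<in>B. \<integral>w. u l w * walsh p (B - {l}) w \<partial>P)"
      using B card by (simp add: integral_process_walsh sum_permutations_by_last[OF B \<open>B \<noteq> {}\<close>])
    finally show ?thesis .
  qed
  finally show ?thesis .
qed

lemma summands_tendsto_skorohod: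
  "L2_tendsto P (\<lambda>A w. \<Sum>k\<in>A. summand k (u k) w) (\<lambda>w. skorohod w) (finite_subsets_at_top UNIV)"
proof -
  obtain G where G: "L2_tendsto P (\<lambda>A w. \<Sum>k\<in>A. summand k (u k) w) G (finite_subsets_at_top UNIV)"
    by (rule L2_unconditional_convergence[of UNIV "\<lambda>k. summand k (u k)" "\<lambda>k. 2 * energy_bound k"])
      (auto intro: L2_summand L2_process summable_on_cmult_right energy_bound_summable
        energy_bound_nonneg integral_summands_square_le)
  have "(\<integral>w. G w * walsh p B w \<partial>P) = (\<integral>w. skorohod w * walsh p B w \<partial>P)" if B: "finite B" for B
  proof -
    \<comment> \<open>Only indices in B contribute, by \<open>integral_summand_walsh\<close>, so the
      pairing is constant as soon as A contains B.\<close>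
    have "(\<integral>w. (\<Sum>k\<in>A. summand k (u k) w) * walsh p B w \<partial>P) = (\<integral>w. skorohod w * walsh p B w \<partial>P)"
      if A: "finite A" "B \<subseteq> A" for A
    proof -
      have "(\<integral>w. (\<Sum>k\<in>A. summand k (u k) w) * walsh p B w \<partial>P)
          = (\<Sum>k\<in>A. \<integral>w. summand k (u k) w * walsh p B w \<partial>P)"
        unfolding sum_distrib_right
        by (intro Bochner_Integration.integral_sum L2_integrable_mult L2_summand L2_process L2_walsh B)
      also have "\<dots> = (\<Sum>k\<in>B. \<integral>w. u k w * walsh p (B - {k}) w \<partial>P)"
        using A by (intro sum.mono_neutral_cong_right)
          (auto simp: integral_summand_walsh[OF L2_process B])
      finally show ?thesis unfolding integral_skorohod_walsh[OF B] .
    qed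
    then have "\<forall>\<^sub>F A in finite_subsets_at_top UNIV.
        (\<integral>w. (\<Sum>k\<in>A. summand k (u k) w) * walsh p B w \<partial>P) = (\<integral>w. skorohod w * walsh p B w \<partial>P)"
      unfolding eventually_finite_subsets_at_top using B by (intro exI[of _ B]) simp
    from tendsto_eventually[OF this] L2_tendsto_inner[OF G L2_walsh[OF B]]
    show ?thesis using tendsto_unique finite_subsets_at_top_neq_bot by blast
  qed
  then have "AE w in P. G w = skorohod w"
    by (intro walsh_coefficients_unique L2_tendstoD(1)[OF G] L2_skorohod)
  then show ?thesis by (rule L2_tendsto_cong_limit[OF G L2_skorohod])
qed

end

end

text \<open>Every finite set of pairs lies in a square. A convergent unordered sum over pairs of
  distinct indices can therefore be computed along squares without their diagonal.\<close>

lemma filterlim_square_off_diagonal: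
  "filterlim (\<lambda>n::nat. {(k, l). k \<in> {..<n} \<and> l \<in> {..<n} \<and> k \<noteq> l})
    (finite_subsets_at_top {(k, l). k \<noteq> l}) sequentially"
  unfolding filterlim_finite_subsets_at_top
proof (intro allI impI)
  fix X :: "(nat \<times> nat) set" assume X: "finite X \<and> X \<subseteq> {(k, l). k \<noteq> l}"
  then obtain N where N: "fst ` X \<union> snd ` X \<subseteq> {..<N}"
    using finite_nat_iff_bounded[of "fst ` X \<union> snd ` X"] by auto
  have "finite {(k, l). k \<in> {..<n} \<and> l \<in> {..<n} \<and> k \<noteq> l}" for n :: nat
    by (rule finite_subset[of _ "{..<n} \<times> {..<n}"]) auto
  moreover have "X \<subseteq> {(k, l). k \<in> {..<n} \<and> l \<in> {..<n} \<and> k \<noteq> l}" if "N \<le> n" for n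
  proof
    fix z assume z: "z \<in> X"
    then have "fst z < n" "snd z < n"
      using N that by force+
    with z X show "z \<in> {(k, l). k \<in> {..<n} \<and> l \<in> {..<n} \<and> k \<noteq> l}" by auto
  qed
  ultimately show "\<forall>\<^sub>F n in sequentially.
      finite {(k, l). k \<in> {..<n} \<and> l \<in> {..<n} \<and> k \<noteq> l} \<and>
      X \<subseteq> {(k, l). k \<in> {..<n} \<and> l \<in> {..<n} \<and> k \<noteq> l} \<and>
      {(k, l). k \<in> {..<n} \<and> l \<in> {..<n} \<and> k \<noteq> l} \<subseteq> {(k, l). k \<noteq> l}"
    by (intro eventually_sequentiallyI[of N]) auto
qed

section \<open>Linearity of the extension and its agreement with the divergence\<close>

lemma L2_sums_suminf: "L2_summable M g \<Longrightarrow> L2_sums M g (L2_suminf M g)"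
  unfolding L2_summable_def L2_suminf_def by (erule someI_ex)

lemma L2_sums_combination:
  assumes g: "L2_sums M g S" and h: "L2_sums M h T"
    and r: "\<And>k. r k \<in> borel_measurable M" "\<And>k. AE w in M. r k w = a * g k w + b * h k w"
  shows "L2_sums M r (\<lambda>w. a * S w + b * T w)"
  unfolding L2_sums_def
proof (rule L2_tendsto_cong_AE)
  show "L2_tendsto M (\<lambda>n w. a * (\<Sum>k<n. g k w) + b * (\<Sum>k<n. h k w)) (\<lambda>w. a * S w + b * T w) sequentially"
    using g h unfolding L2_sums_def by (intro L2_tendsto_add L2_tendsto_cmult)
  show "(\<lambda>w. \<Sum>k<n. r k w) \<in> borel_measurable M" for n
    using r(1) by simp
  \<comment> \<open>Countably many exceptional null sets are merged into one, off which all partial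
    sums agree.\<close>
  have "AE w in M. \<forall>k. r k w = a * g k w + b * h k w"
    using r(2) by (simp add: AE_all_countable)
  then show "AE w in M. (\<Sum>k<n. r k w) = a * (\<Sum>k<n. g k w) + b * (\<Sum>k<n. h k w)" for n
    by eventually_elim (simp add: sum.distrib sum_distrib_left)
qed

lemma
  assumes g: "L2_summable M g" and h: "L2_summable M h"
    and r: "\<And>k. r k \<in> borel_measurable M" "\<And>k. AE w in M. r k w = a * g k w + b * h k w"
  shows L2_summable_combination: "L2_summable M r"
    and L2_suminf_combination: "AE w in M. L2_suminf M r w = a * L2_suminf M g w + b * L2_suminf M h w"
proof -
  have sums: "L2_sums M r (\<lambda>w. a * L2_suminf M g w + b * L2_suminf M h w)"
    by (rule L2_sums_combination[OF L2_sums_suminf[OF g] L2_sums_suminf[OF h] r])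
  then show r: "L2_summable M r"
    by (auto simp: L2_summable_def)
  show "AE w in M. L2_suminf M r w = a * L2_suminf M g w + b * L2_suminf M h w"
    using L2_sums_suminf[OF r] sums unfolding L2_sums_def
    by (rule L2_tendsto_unique) simp
qed

context bernoulli
begin

lemma measurable_process: "u \<in> process_L2 p \<Longrightarrow> u k \<in> borel_measurable P"
  using measurable_compose[OF measurable_Pair2'[of k "count_space UNIV" P],
      of "\<lambda>(w, k). u k w" borel]
  by (simp add: process_L2_def L2_def)

lemma divergence_ext_linear: "L2_process_linear p (ext_domain p) (divergence_ext p)"
  unfolding L2_process_linear_def
proof (intro ballI allI impI)
  fix u v w :: "nat \<Rightarrow> (nat \<Rightarrow> real) \<Rightarrow> real" and a b :: real
  assume u: "u \<in> ext_domain p" and v: "v \<in> ext_domain p" and w: "w \<in> process_L2 p"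
    and AE_w: "\<forall>k. AE x in P. w k x = a * u k x + b * v k x"
  have [measurable]: "w k \<in> borel_measurable P" "D k (w k) \<in> borel_measurable P" for k
    using measurable_process[OF w] measurable_D by auto
  \<comment> \<open>The gradient evaluates its argument at modified points. It respects almost sure
    equality because preimages of null sets under the modification are null.\<close>
  have AE_D: "AE x in P. D k (w k) x = a * D k (u k) x + b * D k (v k) x" for k
    using D_cong_AE[of "w k" "\<lambda>x. a * u k x + b * v k x" k] AE_w by (simp add: grad_add grad_cmult)
  have AE_Y: "AE x in P. w k x * Y p k x = a * (u k x * Y p k x) + b * (v k x * Y p k x)" for k
    using AE_w[rule_format, of k] by eventually_elim (simp add: algebra_simps)
  have AE_phi: "AE x in P. phi p k * D k (w k) x * Y p k x
      = a * (phi p k * D k (u k) x * Y p k x) + b * (phi p k * D k (v k) x * Y p k x)" for k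
    using AE_D[of k] by eventually_elim (simp add: algebra_simps)
  have conv: "series_converge p u" "series_converge p v"
    using u v by (auto simp: ext_domain_def)
  note c = conv[unfolded series_converge_def]
  have 1: "(\<lambda>x. w k x * Y p k x) \<in> borel_measurable P" for k by measurable
  have 2: "(\<lambda>x. D k (w k) x) \<in> borel_measurable P" for k by measurable
  have 3: "(\<lambda>x. phi p k * D k (w k) x * Y p k x) \<in> borel_measurable P" for k by measurable
  have "w \<in> ext_domain p"
    using c w L2_summable_combination[OF _ _ 1 AE_Y] L2_summable_combination[OF _ _ 2 AE_D]
      L2_summable_combination[OF _ _ 3 AE_phi]
    by (simp add: ext_domain_def series_converge_def)
  moreover have "AE x in P. L2_suminf P (\<lambda>k x. w k x * Y p k x) x
      = a * L2_suminf P (\<lambda>k x. u k x * Y p k x) x + b * L2_suminf P (\<lambda>k x. v k x * Y p k x) x"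
    using c by (intro L2_suminf_combination[OF _ _ 1 AE_Y]) auto
  moreover have "AE x in P. L2_suminf P (\<lambda>k x. D k (w k) x) x
      = a * L2_suminf P (\<lambda>k x. D k (u k) x) x + b * L2_suminf P (\<lambda>k x. D k (v k) x) x"
    using c by (intro L2_suminf_combination[OF _ _ 2 AE_D]) auto
  moreover have "AE x in P. L2_suminf P (\<lambda>k x. phi p k * D k (w k) x * Y p k x) x
      = a * L2_suminf P (\<lambda>k x. phi p k * D k (u k) x * Y p k x) x
        + b * L2_suminf P (\<lambda>k x. phi p k * D k (v k) x * Y p k x) x"
    using c by (intro L2_suminf_combination[OF _ _ 3 AE_phi]) auto
  then have "AE x in P. divergence_ext p w x = a * divergence_ext p u x + b * divergence_ext p v x"
    using calculation(2,3) unfolding divergence_ext_def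
    by eventually_elim (simp add: algebra_simps)
  ultimately show "w \<in> ext_domain p \<and>
      (AE x in P. divergence_ext p w x = a * divergence_ext p u x + b * divergence_ext p v x)"
    by blast
qed

text \<open>\<open>divergence\<close> is one of the values given by the expansions of u; the facts
  proved for an arbitrary expansion are later applied to the one obtained here.\<close>

lemma divergence_expansion:
  assumes "u \<in> chaos_processes p"
  obtains n f where "chaos_expansion p n f u"
    "divergence p u = (\<lambda>w. \<Sum>j\<le>n. multint p (j + 1) (symmetrization j (f j)) w)"
proof -
  have "\<exists>G. is_divergence p u G"
    using assms by (auto simp: chaos_processes_def is_divergence_def)
  then have "is_divergence p u (divergence p u)"
    unfolding divergence_def by (rule someI_ex)
  then show thesis using that by (auto simp: is_divergence_def)
qed

text \<open>On the sample space the three partial sums combine to the partial sum of the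
  \<open>summand k (u k)\<close>. The divergence is a limit of that same sequence, and mean square
  limits are unique almost surely.\<close>

lemma divergence_ext_eq_divergence:
  assumes u: "u \<in> chaos_processes p" and conv: "series_converge p u"
  shows "AE w in P. divergence_ext p u w = divergence p u w"
proof -
  obtain n f where ex: "chaos_expansion p n f u"
    and div: "divergence p u = (\<lambda>w. \<Sum>j\<le>n. multint p (j + 1) (symmetrization j (f j)) w)"
    by (rule divergence_expansion[OF u])
  have div_lim: "L2_tendsto P (\<lambda>N w. \<Sum>k<N. summand k (u k) w) (divergence p u) sequentially"
    unfolding div by (rule L2_tendsto_filterlim[OF summands_tendsto_skorohod[OF ex]
          filterlim_lessThan_at_top])
  have "L2_tendsto P
      (\<lambda>N w. (\<Sum>k<N. u k w * Y p k w) - (\<Sum>k<N. D k (u k) w) - (\<Sum>k<N. phi p k * D k (u k) w * Y p k w))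
      (\<lambda>w. divergence_ext p u w) sequentially"
    unfolding divergence_ext_def
    using conv[unfolded series_converge_def] L2_sums_suminf[unfolded L2_sums_def]
    by (intro L2_tendsto_diff) blast+
  then have "L2_tendsto P (\<lambda>N w. \<Sum>k<N. summand k (u k) w) (\<lambda>w. divergence_ext p u w) sequentially"
  proof (rule L2_tendsto_cong_AE)
    show "(\<lambda>w. \<Sum>k<N. summand k (u k) w) \<in> borel_measurable P" for N
      by (intro L2_measurable L2_sum L2_summand L2_process[OF ex])
    show "AE w in P. (\<Sum>k<N. summand k (u k) w)
        = (\<Sum>k<N. u k w * Y p k w) - (\<Sum>k<N. D k (u k) w) - (\<Sum>k<N. phi p k * D k (u k) w * Y p k w)" for N
      by (intro AE_I2) (simp add: summand_eq sum_subtractf)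
  qed
  then show ?thesis
    using div_lim by (rule L2_tendsto_unique) simp
qed

section \<open>Summability of the energies and the isometry\<close>

context
  fixes n :: nat and f :: "nat \<Rightarrow> nat list \<Rightarrow> real" and u :: "nat \<Rightarrow> (nat \<Rightarrow> real) \<Rightarrow> real"
  assumes ex: "chaos_expansion p n f u"
begin

lemma energy_summable: "(\<lambda>k. \<integral>w. \<bar>(u k w)\<^sup>2\<bar> \<partial>P) summable_on UNIV"
  by (rule summable_on_comparison_test[OF energy_bound_summable[OF ex]])
    (simp_all add: integral_process_square_le[OF ex])

text \<open>Enclosing a finite set of pairs in a rectangle permits summing over k first, where the
  energy bound of \<open>u l\<close> applies whatever the range of k.\<close>

lemma grad_energy_summable: "(\<lambda>(k, l). \<integral>w. (D k (u l) w)\<^sup>2 \<partial>P) summable_on UNIV"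
proof (rule nonneg_bdd_above_summable_on)
  have "(\<Sum>(k, l)\<in>F. \<integral>w. (D k (u l) w)\<^sup>2 \<partial>P) \<le> (\<Sum>\<^sub>\<infinity>l. energy_bound n f l)"
    if F: "finite F" for F
  proof -
    let ?K = "fst ` F" and ?L = "snd ` F"
    have "(\<Sum>(k, l)\<in>F. \<integral>w. (D k (u l) w)\<^sup>2 \<partial>P) \<le> (\<Sum>(k, l)\<in>?K \<times> ?L. \<integral>w. (D k (u l) w)\<^sup>2 \<partial>P)"
      using F by (intro sum_mono2) (force simp: image_iff)+
    also have "\<dots> = (\<Sum>l\<in>?L. \<Sum>k\<in>?K. \<integral>w. (D k (u l) w)\<^sup>2 \<partial>P)"
      by (simp add: sum.cartesian_product[symmetric] sum.swap[of _ ?K])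
    also have "\<dots> \<le> (\<Sum>l\<in>?L. energy_bound n f l)"
      using F by (intro sum_mono sum_integral_D_process_le[OF ex]) auto
    also have "\<dots> \<le> (\<Sum>\<^sub>\<infinity>l. energy_bound n f l)"
      using F by (intro finite_sum_le_infsum energy_bound_summable[OF ex] energy_bound_nonneg[OF ex]) auto
    finally show ?thesis .
  qed
  then show "bdd_above (sum (\<lambda>(k, l). \<integral>w. (D k (u l) w)\<^sup>2 \<partial>P) ` {F. F \<subseteq> UNIV \<and> finite F})"
    by (intro bdd_aboveI) auto
qed auto

lemma diagonal_energy_summable: "(\<lambda>k. \<integral>w. \<bar>(D k (u k) w)\<^sup>2\<bar> \<partial>P) summable_on UNIV"
  using summable_on_inj_into[OF grad_energy_summable, of "\<lambda>k. (k, k)" UNIV] by (simp add: inj_on_def)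

text \<open>The absolute value stands inside the integral, as exchanging sum and integral by
  \<open>integral_infsum\<close> requires. The mixed product is dominated by two squared gradients,
  which \<open>prod.swap\<close> carries into each other.\<close>

lemma cross_summable:
  "(\<lambda>z. \<integral>w. \<bar>(case z of (k, l) \<Rightarrow> D k (u l) w * D l (u k) w)\<bar> \<partial>P) summable_on {(k, l). k \<noteq> l}"
proof (rule summable_on_comparison_test)
  have "(\<lambda>z. (\<lambda>(k, l). \<integral>w. (D k (u l) w)\<^sup>2 \<partial>P) (prod.swap z)) summable_on UNIV"
    by (rule summable_on_inj_into[OF grad_energy_summable]) auto
  from summable_on_add[OF grad_energy_summable this]
  show "(\<lambda>z. (\<lambda>(k, l). \<integral>w. (D k (u l) w)\<^sup>2 \<partial>P) z + (\<lambda>(k, l). \<integral>w. (D k (u l) w)\<^sup>2 \<partial>P) (prod.swap z))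
      summable_on {(k, l). k \<noteq> l}"
    by (rule summable_on_subset) simp
  fix z :: "nat \<times> nat"
  obtain k l where z: "z = (k, l)" by (cases z)
  have "(\<integral>w. \<bar>D k (u l) w * D l (u k) w\<bar> \<partial>P) \<le> (\<integral>w. (D k (u l) w)\<^sup>2 + (D l (u k) w)\<^sup>2 \<partial>P)"
  proof (rule integral_mono)
    show "integrable P (\<lambda>w. \<bar>D k (u l) w * D l (u k) w\<bar>)"
      by (intro integrable_abs L2_integrable_mult L2_D L2_process[OF ex])
    show "integrable P (\<lambda>w. (D k (u l) w)\<^sup>2 + (D l (u k) w)\<^sup>2)"
      by (intro Bochner_Integration.integrable_add L2_integrable_square L2_D L2_process[OF ex])
    show "\<bar>D k (u l) w * D l (u k) w\<bar> \<le> (D k (u l) w)\<^sup>2 + (D l (u k) w)\<^sup>2" for w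
    proof -
      have "2 * \<bar>D k (u l) w * D l (u k) w\<bar> \<le> (D k (u l) w)\<^sup>2 + (D l (u k) w)\<^sup>2"
        using sum_squares_bound[of "\<bar>D k (u l) w\<bar>" "\<bar>D l (u k) w\<bar>"] by (simp add: abs_mult)
      then show ?thesis using abs_ge_zero[of "D k (u l) w * D l (u k) w"] by linarith
    qed
  qed
  also have "\<dots> = (\<integral>w. (D k (u l) w)\<^sup>2 \<partial>P) + (\<integral>w. (D l (u k) w)\<^sup>2 \<partial>P)"
    by (intro Bochner_Integration.integral_add L2_integrable_square L2_D L2_process[OF ex])
  finally show "(\<integral>w. \<bar>(case z of (k, l) \<Rightarrow> D k (u l) w * D l (u k) w)\<bar> \<partial>P)
      \<le> (\<lambda>(k, l). \<integral>w. (D k (u l) w)\<^sup>2 \<partial>P) z + (\<lambda>(k, l). \<integral>w. (D k (u l) w)\<^sup>2 \<partial>P) (prod.swap z)"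
    by (simp add: z)
qed simp

lemma integrable_cross:
  "integrable P (\<lambda>w. case z of (k, l) \<Rightarrow> D k (u l) w * D l (u k) w)"
  by (cases z) (auto intro!: L2_integrable_mult L2_D L2_process[OF ex])

text \<open>Both sides are limits of \<open>integral_summands_square\<close> over
  \<open>{..<N}\<close>: the left by mean square convergence to the divergence, the right by
  summability of the three series.\<close>

lemma isometry:
  "(\<integral>w. (\<Sum>j\<le>n. multint p (j + 1) (symmetrization j (f j)) w)\<^sup>2 \<partial>P)
    = (\<Sum>\<^sub>\<infinity>k. \<integral>w. (u k w)\<^sup>2 \<partial>P) - (\<Sum>\<^sub>\<infinity>k. \<integral>w. (D k (u k) w)\<^sup>2 \<partial>P)
      + (\<Sum>\<^sub>\<infinity>z\<in>{(k, l). k \<noteq> l}. \<integral>w. (case z of (k, l) \<Rightarrow> D k (u l) w * D l (u k) w) \<partial>P)"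
proof -
  let ?\<delta> = "\<lambda>w. \<Sum>j\<le>n. multint p (j + 1) (symmetrization j (f j)) w"
  let ?e = "\<lambda>z. \<integral>w. (case z of (k, l) \<Rightarrow> D k (u l) w * D l (u k) w) \<partial>P"
  have partial_sums: "(\<lambda>N. sum \<phi> {..<N}) \<longlonglongrightarrow> infsum \<phi> UNIV" if "\<phi> summable_on UNIV" for \<phi> :: "nat \<Rightarrow> real"
    using has_sum_infsum[OF that] filterlim_compose[OF _ filterlim_lessThan_at_top]
    unfolding has_sum_def by blast
  have "(\<lambda>z. \<bar>?e z\<bar>) summable_on {(k, l). k \<noteq> l}"
    by (rule summable_on_comparison_test[OF cross_summable]) (auto intro: integral_abs_bound)
  then have "?e summable_on {(k, l). k \<noteq> l}"
    using summable_on_iff_abs_summable_on_real by fastforce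
  then have cross: "(\<lambda>N. \<Sum>z\<in>{(k, l). k \<in> {..<N} \<and> l \<in> {..<N} \<and> k \<noteq> l}. ?e z)
      \<longlonglongrightarrow> infsum ?e {(k, l). k \<noteq> l}"
    using has_sum_infsum filterlim_compose[OF _ filterlim_square_off_diagonal]
    unfolding has_sum_def by blast
  have "(\<lambda>N. (\<Sum>k<N. \<integral>w. (u k w)\<^sup>2 \<partial>P) - (\<Sum>k<N. \<integral>w. (D k (u k) w)\<^sup>2 \<partial>P)
      + (\<Sum>z\<in>{(k, l). k \<in> {..<N} \<and> l \<in> {..<N} \<and> k \<noteq> l}. ?e z))
      \<longlonglongrightarrow> (\<Sum>\<^sub>\<infinity>k. \<integral>w. (u k w)\<^sup>2 \<partial>P) - (\<Sum>\<^sub>\<infinity>k. \<integral>w. (D k (u k) w)\<^sup>2 \<partial>P)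
      + infsum ?e {(k, l). k \<noteq> l}"
    using energy_summable diagonal_energy_summable by (intro tendsto_intros partial_sums cross) simp_all
  moreover have "(\<Sum>k<N. \<integral>w. (u k w)\<^sup>2 \<partial>P) - (\<Sum>k<N. \<integral>w. (D k (u k) w)\<^sup>2 \<partial>P)
      + (\<Sum>z\<in>{(k, l). k \<in> {..<N} \<and> l \<in> {..<N} \<and> k \<noteq> l}. ?e z)
      = (\<integral>w. (\<Sum>k<N. summand k (u k) w)\<^sup>2 \<partial>P)" for N
    unfolding integral_summands_square[OF L2_process[OF ex] finite_lessThan] sum_subtractf
    by (auto intro!: sum.cong)
  moreover have "(\<lambda>N. \<integral>w. (\<Sum>k<N. summand k (u k) w)\<^sup>2 \<partial>P) \<longlonglongrightarrow> (\<integral>w. (?\<delta> w)\<^sup>2 \<partial>P)"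
    by (rule L2_tendsto_integral_square[OF L2_tendsto_filterlim[OF summands_tendsto_skorohod[OF ex]
            filterlim_lessThan_at_top]])
  ultimately show ?thesis
    using LIMSEQ_unique by simp
qed

end

end

theorem proposition9p3:
  fixes p :: "nat \<Rightarrow> real"
  assumes p: "\<And>k. 0 < p k \<and> p k < 1"
  shows "(L2_process_linear p (ext_domain p) (divergence_ext p) \<and>
          (\<forall>u\<in>chaos_processes p. series_converge p u \<longrightarrow>
             (AE \<omega> in bernoulli_space p. divergence_ext p u \<omega> = divergence p u \<omega>))) \<and>
         (\<forall>u\<in>chaos_processes p.
            divergence p u \<in> L2 (bernoulli_space p) \<and>
            (AE \<omega> in bernoulli_space p.
               (\<lambda>k. (u k \<omega>)\<^sup>2) summable_on UNIV \<and>
               (\<lambda>(k, l). grad p k (u l) \<omega> * grad p l (u k) \<omega>) summable_on {(k, l). k \<noteq> l} \<and>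
               (\<lambda>k. (grad p k (u k) \<omega>)\<^sup>2) summable_on UNIV) \<and>
            integrable (bernoulli_space p) (\<lambda>\<omega>. \<Sum>\<^sub>\<infinity>k. (u k \<omega>)\<^sup>2) \<and>
            integrable (bernoulli_space p) (\<lambda>\<omega>.
               (\<Sum>\<^sub>\<infinity>(k, l)\<in>{(k, l). k \<noteq> l}. grad p k (u l) \<omega> * grad p l (u k) \<omega>)
               - (\<Sum>\<^sub>\<infinity>k. (grad p k (u k) \<omega>)\<^sup>2)) \<and>
            (\<integral>\<omega>. \<bar>divergence p u \<omega>\<bar>\<^sup>2 \<partial>bernoulli_space p) =
              (\<integral>\<omega>. (\<Sum>\<^sub>\<infinity>k. (u k \<omega>)\<^sup>2) \<partial>bernoulli_space p) +
              (\<integral>\<omega>. (\<Sum>\<^sub>\<infinity>(k, l)\<in>{(k, l). k \<noteq> l}. grad p k (u l) \<omega> * grad p l (u k) \<omega>)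
                    - (\<Sum>\<^sub>\<infinity>k. (grad p k (u k) \<omega>)\<^sup>2) \<partial>bernoulli_space p))"
proof -
  interpret bernoulli p by standard (rule p)
  have "divergence p u \<in> L2 P \<and>
      (AE w in P. (\<lambda>k. (u k w)\<^sup>2) summable_on UNIV \<and>
         (\<lambda>(k, l). D k (u l) w * D l (u k) w) summable_on {(k, l). k \<noteq> l} \<and>
         (\<lambda>k. (D k (u k) w)\<^sup>2) summable_on UNIV) \<and>
      integrable P (\<lambda>w. \<Sum>\<^sub>\<infinity>k. (u k w)\<^sup>2) \<and>
      integrable P (\<lambda>w. (\<Sum>\<^sub>\<infinity>(k, l)\<in>{(k, l). k \<noteq> l}. D k (u l) w * D l (u k) w)
        - (\<Sum>\<^sub>\<infinity>k. (D k (u k) w)\<^sup>2)) \<and>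
      (\<integral>w. \<bar>divergence p u w\<bar>\<^sup>2 \<partial>P) = (\<integral>w. (\<Sum>\<^sub>\<infinity>k. (u k w)\<^sup>2) \<partial>P) +
        (\<integral>w. (\<Sum>\<^sub>\<infinity>(k, l)\<in>{(k, l). k \<noteq> l}. D k (u l) w * D l (u k) w)
          - (\<Sum>\<^sub>\<infinity>k. (D k (u k) w)\<^sup>2) \<partial>P)"
    if u: "u \<in> chaos_processes p" for u
  proof -
    obtain n f where ex: "chaos_expansion p n f u"
      and div: "divergence p u = (\<lambda>w. \<Sum>j\<le>n. multint p (j + 1) (symmetrization j (f j)) w)"
      by (rule divergence_expansion[OF u])
    note int_u = L2_integrable_square[OF L2_process[OF ex]]
    note int_D = L2_integrable_square[OF L2_D[OF L2_process[OF ex]]]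
    note u_series = AE_summable_on[OF int_u energy_summable[OF ex]]
      integrable_infsum[OF int_u energy_summable[OF ex]]
      integral_infsum[OF int_u energy_summable[OF ex]]
    note D_series = AE_summable_on[OF int_D diagonal_energy_summable[OF ex]]
      integrable_infsum[OF int_D diagonal_energy_summable[OF ex]]
      integral_infsum[OF int_D diagonal_energy_summable[OF ex]]
    note cross_series = AE_summable_on[OF integrable_cross[OF ex] cross_summable[OF ex]]
      integrable_infsum[OF integrable_cross[OF ex] cross_summable[OF ex]]
      integral_infsum[OF integrable_cross[OF ex] cross_summable[OF ex]]
    have "AE w in P. (\<lambda>k. (u k w)\<^sup>2) summable_on UNIV \<and>
        (\<lambda>(k, l). D k (u l) w * D l (u k) w) summable_on {(k, l). k \<noteq> l} \<and>
        (\<lambda>k. (D k (u k) w)\<^sup>2) summable_on UNIV"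
      using u_series(1) cross_series(1) D_series(1) by eventually_elim simp
    moreover have "(\<integral>w. (\<Sum>\<^sub>\<infinity>(k, l)\<in>{(k, l). k \<noteq> l}. D k (u l) w * D l (u k) w)
          - (\<Sum>\<^sub>\<infinity>k. (D k (u k) w)\<^sup>2) \<partial>P)
        = (\<integral>w. (\<Sum>\<^sub>\<infinity>(k, l)\<in>{(k, l). k \<noteq> l}. D k (u l) w * D l (u k) w) \<partial>P)
          - (\<integral>w. (\<Sum>\<^sub>\<infinity>k. (D k (u k) w)\<^sup>2) \<partial>P)"
      by (intro Bochner_Integration.integral_diff cross_series(2) D_series(2))
    \<comment> \<open>Moving the expectations inside the three series reduces the equation to
      \<open>isometry\<close>.\<close>
    moreover have "(\<integral>w. \<bar>divergence p u w\<bar>\<^sup>2 \<partial>P) = (\<integral>w. (\<Sum>\<^sub>\<infinity>k. (u k w)\<^sup>2) \<partial>P)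
        - (\<integral>w. (\<Sum>\<^sub>\<infinity>k. (D k (u k) w)\<^sup>2) \<partial>P)
        + (\<integral>w. (\<Sum>\<^sub>\<infinity>(k, l)\<in>{(k, l). k \<noteq> l}. D k (u l) w * D l (u k) w) \<partial>P)"
      unfolding u_series(3) D_series(3) cross_series(3) isometry[OF ex, symmetric] div power2_abs
      by (rule refl)
    ultimately show ?thesis
      using L2_skorohod[OF ex] u_series(2) cross_series(2) D_series(2)
      by (intro conjI Bochner_Integration.integrable_diff) (simp_all add: div)
  qed
  then show ?thesis
    using divergence_ext_linear divergence_ext_eq_divergence by blast
qed

end
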